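(* The following problem is undecidable: given $n \ge 0$ and a program $P \in \mathit{MM}^n$, decide whether $P \to^* \mathtt{return}\;\mathtt{true}$. Here, for variables $x_0,x_1,f_0,\dots,f_n$ and an operation name $\mathit{succ}$, $\mathit{Inst}^n$ is the set consisting of $()$ (i.e.\ $\mathtt{return}\;()$), all computations $c_{inc}^{i,j} = \mathtt{let}\;x_i = \mathtt{return}\;(\lambda y.\mathit{succ}\;x_i)\;\mathtt{in}\;f_j\,x_0\,x_1$ for $i\in\{0,1\}$, $j\in\{0,\dots,n\}$, and all computations $c_{dec}^{i,j,m} = \mathtt{with}\;\{\mathtt{return}\;x = f_j\,x_0\,x_1,\ \mathit{succ}\;x_i\;k = f_m\,x_0\,x_1\}\;\mathtt{handle}\;x_i\,()$ for $i\in\{0,1\}$, $j,m\in\{0,\dots,n\}$; and $\mathit{MM}^n$ is the set of programs $\mathtt{mrec}\;f_0 = \lambda x_0.\lambda x_1.c_0\;\mathtt{and}\;\cdots\;\mathtt{and}\;f_n = \lambda x_0.\lambda x_1.c_n\;\mathtt{in}\;(f_0\,(\lambda x.())\,(\lambda x.()));\mathtt{return}\;\mathtt{true}$ with each $c_i \in \mathit{Inst}^n$.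
   Context: Syntax. Values $v ::= x \mid () \mid \mathtt{true} \mid \mathtt{false} \mid \lambda x.c \mid \mathtt{rec}\;x = v$; computations $c ::= \mathtt{return}\;v \mid \mathit{op}\;v \mid v_1\,v_2 \mid \mathtt{if}\;v\;\mathtt{then}\;c_1\;\mathtt{else}\;c_2 \mid \mathtt{let}\;x = c_1\;\mathtt{in}\;c_2 \mid \mathtt{with}\;h\;\mathtt{handle}\;c$; handlers $h ::= \{\mathtt{return}\;x = c,\ \mathit{op}_1\,x_1\,k_1 = c_1, \dots\}$; $\mathtt{rec}\;x=v$ binds $x$ in $v$; in an operation clause $\mathit{op}\;x\;k = c$, $x$ and $k$ are bound in $c$. A program is a closed computation. Notational conventions: a value written where a computation is expected stands for $\mathtt{return}$ of it; $f_j\,x_0\,x_1$ stands for $\mathtt{let}\;w = f_j\,x_0\;\mathtt{in}\;w\,x_1$ ($w$ fresh); $c_1;c_2$ stands for $\mathtt{let}\;z=c_1\;\mathtt{in}\;c_2$ with $z$ not free in $c_2$; $f_0\,(\lambda x.())\,(\lambda x.())$ is similarly desugared. The mutual recursion $\mathtt{mrec}\;f_0=v_0\;\mathtt{and}\dots\mathtt{and}\;f_n=v_n\;\mathtt{in}\;c$ is defined inductively as $\mathtt{let}\;f_0 = \mathtt{return}\,(\mathtt{rec}\;f_0 = (\mathtt{mrec}\;f_1=v_1\;\mathtt{and}\dots\mathtt{and}\;f_n=v_n\;\mathtt{in}\;v_0))\;\mathtt{in}\;\cdots\;\mathtt{let}\;f_n = \mathtt{return}\,(\mathtt{rec}\;f_n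 = (\mathtt{mrec}\;f_0=v_0\;\mathtt{and}\dots\mathtt{and}\;f_{n-1}=v_{n-1}\;\mathtt{in}\;v_n))\;\mathtt{in}\;c$ (with $\mathtt{mrec}$ with no definitions and body a value $v$ meaning $v$). Evaluation contexts: $E ::= [\,] \mid \mathtt{let}\;x = E\;\mathtt{in}\;c$. Semantics: $\to$ is the least relation such that: if $c_1\to c_2$ then $\mathtt{let}\;x=c_1\;\mathtt{in}\;c \to \mathtt{let}\;x=c_2\;\mathtt{in}\;c$; $\mathtt{let}\;x=\mathtt{return}\;v\;\mathtt{in}\;c \to c[v/x]$; $(\lambda x.c)\,v \to c[v/x]$; $(\mathtt{rec}\;x=v)\,v' \to v[(\mathtt{rec}\;x=v)/x]\,v'$; $\mathtt{if}\;\mathtt{true}\;\mathtt{then}\;c_1\;\mathtt{else}\;c_2 \to c_1$; $\mathtt{if}\;\mathtt{false}\;\mathtt{then}\;c_1\;\mathtt{else}\;c_2 \to c_2$; if $c\to c'$ then $\mathtt{with}\;h\;\mathtt{handle}\;c \to \mathtt{with}\;h\;\mathtt{handle}\;c'$; $\mathtt{with}\;h\;\mathtt{handle}\;\mathtt{return}\;v \to c[v/x]$ where $\mathtt{return}\;x=c$ is the return clause of $h$; $\mathtt{with}\;h\;\mathtt{handle}\;E[\mathit{op}\;v] \to c[v/x, (\lambda y.\mathtt{with}\;h\;\mathtt{handle}\;E[\mathtt{return}\;y])/k]$ where $\mathit{op}\;x\;k = c$ is a clause of $h$. $\to^*$ is the reflexive-transitive closure.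
   Formalization: For n ≥ 1 the displayed expansion of mrec puts a let-computation under rec, where only a value is allowed; there, "let f = return w in v" with a value body v is read as the value v[w/f]. The outer let-chain is as displayed. *)

theory Defs
  imports Main "HOL-Library.Nat_Bijection"
begin

section \<open>Decidability\<close>

text \<open>Kleene's partial recursive functions, with a big-step evaluation relation.\<close>

datatype recf =
    RZero
  | RSucc
  | RProj nat
  | RComp recf "recf list"
  | RPrec recf recf
  | RMin recf

inductive reval :: "recf \<Rightarrow> nat list \<Rightarrow> nat \<Rightarrow> bool" where
  reval_Zero: "reval RZero xs 0"
| reval_Succ: "reval RSucc [x] (Suc x)"
| reval_Proj: "i < length xs \<Longrightarrow> reval (RProj i) xs (xs ! i)"
| reval_Comp: "list_all2 (\<lambda>g y. reval g xs y) gs ys \<Longrightarrow> reval f ys z \<Longrightarrow> reval (RComp f gs) xs z"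
| reval_Prec_0: "reval f xs y \<Longrightarrow> reval (RPrec f g) (0 # xs) y"
| reval_Prec_Suc:
    "reval (RPrec f g) (m # xs) y \<Longrightarrow> reval g (m # y # xs) z \<Longrightarrow> reval (RPrec f g) (Suc m # xs) z"
| reval_Min:
    "reval f (m # xs) 0 \<Longrightarrow> (\<forall>i<m. \<exists>y. reval f (i # xs) (Suc y)) \<Longrightarrow> reval (RMin f) xs m"

inductive_cases reval_ZeroE: "reval RZero xs z"
inductive_cases reval_SuccE: "reval RSucc xs z"
inductive_cases reval_ProjE: "reval (RProj i) xs z"
inductive_cases reval_CompE: "reval (RComp f gs) xs z"
inductive_cases reval_PrecE_0: "reval (RPrec f g) (0 # xs) z"
inductive_cases reval_PrecE_Suc: "reval (RPrec f g) (Suc m # xs) z"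
inductive_cases reval_MinE: "reval (RMin f) xs z"

lemma reval_deterministic: "reval r xs y \<Longrightarrow> reval r xs z \<Longrightarrow> y = z"
proof (induction arbitrary: z rule: reval.induct)
  case (reval_Zero xs)
  then show ?case by (rule reval_ZeroE) simp
next
  case (reval_Succ x)
  then show ?case by (rule reval_SuccE) simp
next
  case (reval_Proj i xs)
  from reval_Proj.prems show ?case by (rule reval_ProjE) simp
next
  case (reval_Comp xs gs ys f y)
  from reval_Comp.prems obtain zs where
    zs: "list_all2 (\<lambda>g y. reval g xs y) gs zs" "reval f zs z"
    by (rule reval_CompE)
  have "ys = zs"
  proof (rule nth_equalityI)
    show "length ys = length zs"
      using reval_Comp.IH(1) zs(1) by (simp add: list_all2_conv_all_nth)
    show "ys ! i = zs ! i" if "i < length ys" for i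
      using reval_Comp.IH(1) zs(1) that by (simp add: list_all2_conv_all_nth)
  qed
  with zs(2) reval_Comp.IH(2) show ?case by simp
next
  case (reval_Prec_0 f xs y g)
  from reval_Prec_0.prems have "reval f xs z" by (rule reval_PrecE_0)
  then show ?case by (rule reval_Prec_0.IH)
next
  case (reval_Prec_Suc f g m xs y y')
  from reval_Prec_Suc.prems obtain z' where
    z': "reval (RPrec f g) (m # xs) z'" "reval g (m # z' # xs) z"
    by (rule reval_PrecE_Suc)
  from reval_Prec_Suc.IH(1)[OF z'(1)] z'(2) have "reval g (m # y # xs) z" by simp
  then show ?case by (rule reval_Prec_Suc.IH)
next
  case (reval_Min f m xs)
  from reval_Min.prems have z: "reval f (z # xs) 0" by (rule reval_MinE)
  from reval_Min.prems have z': "\<forall>i<z. \<exists>y. reval f (i # xs) (Suc y)" by (rule reval_MinE)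
  show ?case
  proof (cases m z rule: linorder_cases)
    case less
    with z' obtain y where "reval f (m # xs) (Suc y)" by blast
    then have "0 = Suc y" by (rule reval_Min.IH(1))
    then show ?thesis by simp
  next
    case greater
    with reval_Min.IH(2) obtain y where "\<forall>w. reval f (z # xs) w \<longrightarrow> Suc y = w" by blast
    with z have "Suc y = 0" by blast
    then show ?thesis by simp
  qed
qed

text \<open>
  The decision problem with set of instances \<open>I\<close> and set of positive instances
  \<open>{a \<in> I. Q a}\<close>, where an instance \<open>a\<close> is presented to the algorithm as the number
  \<open>code a\<close>. The algorithm has to halt with the correct answer on every instance; its behaviour
  on numbers that do not encode an instance is irrelevant.
\<close>

definition decidable_problem :: "('a \<Rightarrow> nat) \<Rightarrow> 'a set \<Rightarrow> ('a \<Rightarrow> bool) \<Rightarrow> bool" where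
  "decidable_problem code I Q \<longleftrightarrow>
     (\<exists>r. \<forall>a\<in>I. reval r [code a] (if Q a then 1 else 0))"


section \<open>Syntax\<close>

type_synonym var = nat
type_synonym opn = nat

text \<open>
  \<open>HOp op x k c h\<close> is the handler \<open>h\<close> extended by the clause \<open>op x k = c\<close>.
\<close>

datatype val =
    Var var
  | Unit
  | TT
  | FF
  | Lam var comp
  | Rec var val
and comp =
    Return val
  | Op opn val
  | App val val
  | Cond val comp comp
  | LetIn var comp comp
  | Handle handler comp
and handler =
    HReturn var comp
  | HOp opn var var comp handler

primrec return_clause :: "handler \<Rightarrow> var \<times> comp" where
  "return_clause (HReturn x c) = (x, c)"
| "return_clause (HOp opn x k c h) = return_clause h"

primrec op_clauses :: "handler \<Rightarrow> (opn \<times> var \<times> var \<times> comp) set" where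
  "op_clauses (HReturn x c) = {}"
| "op_clauses (HOp opn x k c h) = insert (opn, x, k, c) (op_clauses h)"

primrec fv_val :: "val \<Rightarrow> var set"
  and fv_comp :: "comp \<Rightarrow> var set"
  and fv_handler :: "handler \<Rightarrow> var set" where
  "fv_val (Var x) = {x}"
| "fv_val Unit = {}"
| "fv_val TT = {}"
| "fv_val FF = {}"
| "fv_val (Lam x c) = fv_comp c - {x}"
| "fv_val (Rec x v) = fv_val v - {x}"
| "fv_comp (Return v) = fv_val v"
| "fv_comp (Op opn v) = fv_val v"
| "fv_comp (App v1 v2) = fv_val v1 \<union> fv_val v2"
| "fv_comp (Cond v c1 c2) = fv_val v \<union> fv_comp c1 \<union> fv_comp c2"
| "fv_comp (LetIn x c1 c2) = fv_comp c1 \<union> (fv_comp c2 - {x})"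
| "fv_comp (Handle h c) = fv_handler h \<union> fv_comp c"
| "fv_handler (HReturn x c) = fv_comp c - {x}"
| "fv_handler (HOp opn x k c h) = (fv_comp c - {x, k}) \<union> fv_handler h"

text \<open>
  Simultaneous capture-avoiding substitution. \<open>fresh_binder \<sigma> x A\<close> is the name that a binder
  \<open>x\<close> whose scope has free variables \<open>A\<close> receives when \<open>\<sigma>\<close> is pushed under it: \<open>x\<close> itself
  unless this would capture a variable.
\<close>

definition fresh_binder :: "(var \<Rightarrow> val) \<Rightarrow> var \<Rightarrow> var set \<Rightarrow> var" where
  "fresh_binder \<sigma> x A =
     (let U = (\<Union>y\<in>A - {x}. fv_val (\<sigma> y)) in if x \<in> U then (LEAST z. z \<notin> U) else x)"

primrec subst_val :: "(var \<Rightarrow> val) \<Rightarrow> val \<Rightarrow> val"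
  and subst_comp :: "(var \<Rightarrow> val) \<Rightarrow> comp \<Rightarrow> comp"
  and subst_handler :: "(var \<Rightarrow> val) \<Rightarrow> handler \<Rightarrow> handler" where
  "subst_val \<sigma> (Var x) = \<sigma> x"
| "subst_val \<sigma> Unit = Unit"
| "subst_val \<sigma> TT = TT"
| "subst_val \<sigma> FF = FF"
| "subst_val \<sigma> (Lam x c) =
     (let x' = fresh_binder \<sigma> x (fv_comp c) in Lam x' (subst_comp (\<sigma>(x := Var x')) c))"
| "subst_val \<sigma> (Rec x v) =
     (let x' = fresh_binder \<sigma> x (fv_val v) in Rec x' (subst_val (\<sigma>(x := Var x')) v))"
| "subst_comp \<sigma> (Return v) = Return (subst_val \<sigma> v)"
| "subst_comp \<sigma> (Op opn v) = Op opn (subst_val \<sigma> v)"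
| "subst_comp \<sigma> (App v1 v2) = App (subst_val \<sigma> v1) (subst_val \<sigma> v2)"
| "subst_comp \<sigma> (Cond v c1 c2) = Cond (subst_val \<sigma> v) (subst_comp \<sigma> c1) (subst_comp \<sigma> c2)"
| "subst_comp \<sigma> (LetIn x c1 c2) =
     (let x' = fresh_binder \<sigma> x (fv_comp c2)
      in LetIn x' (subst_comp \<sigma> c1) (subst_comp (\<sigma>(x := Var x')) c2))"
| "subst_comp \<sigma> (Handle h c) = Handle (subst_handler \<sigma> h) (subst_comp \<sigma> c)"
| "subst_handler \<sigma> (HReturn x c) =
     (let x' = fresh_binder \<sigma> x (fv_comp c) in HReturn x' (subst_comp (\<sigma>(x := Var x')) c))"
| "subst_handler \<sigma> (HOp opn x k c h) =
     (let x' = fresh_binder \<sigma> x (fv_comp c - {k});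
          \<sigma>' = \<sigma>(x := Var x');
          k' = fresh_binder \<sigma>' k (fv_comp c)
      in HOp opn x' k' (subst_comp (\<sigma>'(k := Var k')) c) (subst_handler \<sigma> h))"


section \<open>Semantics\<close>

datatype ectx = Hole | ELet var ectx comp

primrec plug :: "ectx \<Rightarrow> comp \<Rightarrow> comp" where
  "plug Hole c = c"
| "plug (ELet x E c') c = LetIn x (plug E c) c'"

inductive step :: "comp \<Rightarrow> comp \<Rightarrow> bool" (infix "\<rightarrow>c" 50) where
  step_let: "c1 \<rightarrow>c c2 \<Longrightarrow> LetIn x c1 c \<rightarrow>c LetIn x c2 c"
| step_let_return: "LetIn x (Return v) c \<rightarrow>c subst_comp (Var(x := v)) c"
| step_beta: "App (Lam x c) v \<rightarrow>c subst_comp (Var(x := v)) c"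
| step_rec: "App (Rec x v) v' \<rightarrow>c App (subst_val (Var(x := Rec x v)) v) v'"
| step_true: "Cond TT c1 c2 \<rightarrow>c c1"
| step_false: "Cond FF c1 c2 \<rightarrow>c c2"
| step_handle: "c \<rightarrow>c c' \<Longrightarrow> Handle h c \<rightarrow>c Handle h c'"
| step_handle_return:
    "return_clause h = (x, c) \<Longrightarrow> Handle h (Return v) \<rightarrow>c subst_comp (Var(x := v)) c"
| step_handle_op:
    "(opn, x, k, c) \<in> op_clauses h \<Longrightarrow>
     y \<notin> fv_comp (Handle h (plug E (Op opn v))) \<Longrightarrow>
     Handle h (plug E (Op opn v)) \<rightarrow>c
       subst_comp (Var(x := v, k := Lam y (Handle h (plug E (Return (Var y)))))) c"

abbreviation steps :: "comp \<Rightarrow> comp \<Rightarrow> bool" (infix "\<rightarrow>c*" 50) where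
  "c \<rightarrow>c* c' \<equiv> step\<^sup>*\<^sup>* c c'"


section \<open>Mutual recursion\<close>

text \<open>
  \<open>mrec_binds ds\<close> lists the bindings \<open>f\<^sub>i = rec f\<^sub>i = (mrec (ds without its i-th entry) in v\<^sub>i)\<close>
  introduced by \<open>mrec ds in _\<close>. The body of \<open>rec\<close> has to be a value, so for a value body \<open>v\<close>
  the nested chain \<open>let f\<^sub>0 = return w\<^sub>0 in \<dots> in v\<close> denotes the value obtained by performing the
  substitutions \<open>w\<^sub>i\<close> for \<open>f\<^sub>i\<close>, in accordance with the reduction rule for \<open>let\<close>.
\<close>

function mrec_binds :: "(var \<times> val) list \<Rightarrow> (var \<times> val) list" where
  "mrec_binds ds =
     map (\<lambda>i. (fst (ds ! i),
               Rec (fst (ds ! i))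
                 (foldr (\<lambda>(f, w) v. subst_val (Var(f := w)) v)
                    (mrec_binds (take i ds @ drop (Suc i) ds)) (snd (ds ! i)))))
       [0..<length ds]"
  by auto
termination by (relation "measure length") auto

declare mrec_binds.simps [simp del]

definition mrec :: "(var \<times> val) list \<Rightarrow> comp \<Rightarrow> comp" where
  "mrec ds c = foldr (\<lambda>(f, w) c. LetIn f (Return w) c) (mrec_binds ds) c"


section \<open>The programs\<close>

text \<open>
  Pairwise distinct names: \<open>xvar 0\<close>, \<open>xvar 1\<close> and \<open>fvar j\<close> are the variables \<open>x\<^sub>0\<close>, \<open>x\<^sub>1\<close> and
  \<open>f\<^sub>j\<close>; \<open>xvar\<close> is only used at \<open>0\<close> and \<open>1\<close>.
\<close>

definition xvar :: "nat \<Rightarrow> var" where "xvar i = i"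
definition vx :: var where "vx = 2"
definition vy :: var where "vy = 3"
definition vk :: var where "vk = 4"
definition vw :: var where "vw = 5"
definition vz :: var where "vz = 6"
definition fvar :: "nat \<Rightarrow> var" where "fvar j = 7 + j"

definition succ_op :: opn where "succ_op = 0"

definition app2 :: "val \<Rightarrow> val \<Rightarrow> val \<Rightarrow> comp" where
  "app2 u v v' = LetIn vw (App u v) (App (Var vw) v')"

definition call :: "nat \<Rightarrow> comp" where
  "call j = app2 (Var (fvar j)) (Var (xvar 0)) (Var (xvar 1))"

definition c_inc :: "nat \<Rightarrow> nat \<Rightarrow> comp" where
  "c_inc i j = LetIn (xvar i) (Return (Lam vy (Op succ_op (Var (xvar i))))) (call j)"

definition c_dec :: "nat \<Rightarrow> nat \<Rightarrow> nat \<Rightarrow> comp" where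
  "c_dec i j m =
     Handle (HOp succ_op (xvar i) vk (call m) (HReturn vx (call j))) (App (Var (xvar i)) Unit)"

definition Inst :: "nat \<Rightarrow> comp set" where
  "Inst n = {Return Unit}
     \<union> {c_inc i j | i j. i \<in> {0, 1} \<and> j \<le> n}
     \<union> {c_dec i j m | i j m. i \<in> {0, 1} \<and> j \<le> n \<and> m \<le> n}"

definition MM_prog :: "nat \<Rightarrow> (nat \<Rightarrow> comp) \<Rightarrow> comp" where
  "MM_prog n c =
     mrec (map (\<lambda>i. (fvar i, Lam (xvar 0) (Return (Lam (xvar 1) (c i))))) [0..<Suc n])
       (LetIn vz
          (app2 (Var (fvar 0)) (Lam vx (Return Unit)) (Lam vx (Return Unit)))
          (Return TT))"

definition MM :: "nat \<Rightarrow> comp set" where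
  "MM n = {MM_prog n c | c. \<forall>i\<le>n. c i \<in> Inst n}"


section \<open>Goedel numbering of the syntax\<close>

primrec code_val :: "val \<Rightarrow> nat"
  and code_comp :: "comp \<Rightarrow> nat"
  and code_handler :: "handler \<Rightarrow> nat" where
  "code_val (Var x) = prod_encode (0, x)"
| "code_val Unit = prod_encode (1, 0)"
| "code_val TT = prod_encode (2, 0)"
| "code_val FF = prod_encode (3, 0)"
| "code_val (Lam x c) = prod_encode (4, prod_encode (x, code_comp c))"
| "code_val (Rec x v) = prod_encode (5, prod_encode (x, code_val v))"
| "code_comp (Return v) = prod_encode (0, code_val v)"
| "code_comp (Op opn v) = prod_encode (1, prod_encode (opn, code_val v))"
| "code_comp (App v1 v2) = prod_encode (2, prod_encode (code_val v1, code_val v2))"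
| "code_comp (Cond v c1 c2) =
     prod_encode (3, prod_encode (code_val v, prod_encode (code_comp c1, code_comp c2)))"
| "code_comp (LetIn x c1 c2) =
     prod_encode (4, prod_encode (x, prod_encode (code_comp c1, code_comp c2)))"
| "code_comp (Handle h c) = prod_encode (5, prod_encode (code_handler h, code_comp c))"
| "code_handler (HReturn x c) = prod_encode (0, prod_encode (x, code_comp c))"
| "code_handler (HOp opn x k c h) =
     prod_encode (1, prod_encode (opn, prod_encode (x, prod_encode (k,
       prod_encode (code_comp c, code_handler h)))))"

lemma code_inject:
  "code_val v = code_val v' \<Longrightarrow> v = v'"
  "code_comp c = code_comp c' \<Longrightarrow> c = c'"
  "code_handler h = code_handler h' \<Longrightarrow> h = h'"
proof (induction v and c and h arbitrary: v' and c' and h')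
  case (Var x) then show ?case by (cases v') auto
next
  case Unit then show ?case by (cases v') auto
next
  case TT then show ?case by (cases v') auto
next
  case FF then show ?case by (cases v') auto
next
  case (Lam x c) then show ?case by (cases v') auto
next
  case (Rec x v) then show ?case by (cases v') auto
next
  case (Return v) then show ?case by (cases c') auto
next
  case (Op opn v) then show ?case by (cases c') auto
next
  case (App v1 v2) then show ?case by (cases c') auto
next
  case (Cond v c1 c2) then show ?case by (cases c') auto
next
  case (LetIn x c1 c2) then show ?case by (cases c') auto
next
  case (Handle h c) then show ?case by (cases c') auto
next
  case (HReturn x c) then show ?case by (cases h') auto
next
  case (HOp opn x k c h) then show ?case by (cases h') auto
qed

end

theory Submission
  imports Defs "HOL-Computational_Algebra.Primes" "HOL-Library.Infinite_Set"
begin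

text \<open>
  A number \<open>a\<close> presents a two-counter machine together with a block of \<open>prm 0 ^ a\<close> increments
  executed first, so that the machine starts on a Goedel number from which it can recover its own
  presentation \<open>a\<close>. The code of the program in \<open>MM\<close> that simulates this machine is a recursive
  function \<open>q\<close> of \<open>a\<close>: in closed form, the nested mutual recursion is a table indexed by sets of
  functions, and it can be filled in the order of their bit masks. Given a decision procedure
  \<open>r\<close>, the total computation \<open>r \<circ> q\<close> is compiled to loop programs over registers and then, by
  Goedel numbering, to two counters; adding a final test yields a machine that on its own
  presentation halts iff \<open>r\<close> says that it does not. Since only values that \<open>r \<circ> q\<close> does take
  matter, the compilation only has to be correct for terminating evaluations.
\<close>

section \<open>Total recursive functions\<close>

text \<open>A program of \<open>MM\<close> takes no input: both counters start at zero. A machine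
  that is to be confronted with its own code must create it, and a list of instructions cannot
  contain its own code number. The increments are not listed in \<open>a\<close>; their number is
  computed from \<open>a\<close>, so no circularity arises and neither a recursion theorem nor a
  universal machine is involved.

  Two features of the calculus shape the simulation. Each function value contains nested copies of
  the others, and unfolding \<open>rec\<close> substitutes different copies for one and the same
  function; a configuration can thus be matched only up to a relation on values. And reduction is
  not deterministic in general, while the non-halting case needs that no reduction sequence at all
  reaches \<open>return true\<close>; the simulation is therefore carried by steps whose result is
  unique.\<close>

definition recursive :: "nat \<Rightarrow> (nat list \<Rightarrow> nat) \<Rightarrow> bool" where
  "recursive k f \<longleftrightarrow> (\<exists>r. \<forall>xs. length xs = k \<longrightarrow> reval r xs (f xs))"

lemma recursive_comp:
  assumes "recursive (length gs) f" "\<And>g. g \<in> set gs \<Longrightarrow> recursive k g"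
  shows "recursive k (\<lambda>xs. f (map (\<lambda>g. g xs) gs))"
proof -
  from assms(1) obtain r where r: "\<And>xs. length xs = length gs \<Longrightarrow> reval r xs (f xs)"
    by (auto simp: recursive_def)
  from assms(2) have "\<forall>g\<in>set gs. \<exists>r. \<forall>xs. length xs = k \<longrightarrow> reval r xs (g xs)"
    by (simp add: recursive_def)
  then obtain R where R: "\<And>g xs. g \<in> set gs \<Longrightarrow> length xs = k \<Longrightarrow> reval (R g) xs (g xs)" by metis
  have "reval (RComp r (map R gs)) xs (f (map (\<lambda>g. g xs) gs))" if "length xs = k" for xs
  proof (rule reval_Comp)
    show "list_all2 (\<lambda>g y. reval g xs y) (map R gs) (map (\<lambda>g. g xs) gs)"
      using R that by (simp add: list_all2_conv_all_nth)
  qed (simp add: r)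
  then show ?thesis unfolding recursive_def by blast
qed

lemma recursive_comp1:
  assumes "recursive 1 (\<lambda>zs. F (zs ! 0))" "recursive k f"
  shows "recursive k (\<lambda>xs. F (f xs))"
  using recursive_comp[of "[f]" "\<lambda>zs. F (zs ! 0)" k] assms by simp

lemma recursive_comp2:
  assumes "recursive 2 (\<lambda>zs. F (zs ! 0) (zs ! 1))" "recursive k f" "recursive k g"
  shows "recursive k (\<lambda>xs. F (f xs) (g xs))"
  using recursive_comp[of "[f, g]" "\<lambda>zs. F (zs ! 0) (zs ! 1)" k] assms
  by (auto simp: numeral_2_eq_2)

lemma recursive_proj: "i < k \<Longrightarrow> recursive k (\<lambda>xs. xs ! i)"
  unfolding recursive_def by (rule exI[of _ "RProj i"]) (auto intro: reval_Proj)

lemma recursive_Suc: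
  assumes "recursive k f"
  shows "recursive k (\<lambda>xs. Suc (f xs))"
proof (rule recursive_comp1[OF _ assms])
  have "reval RSucc xs (Suc (xs ! 0))" if "length xs = 1" for xs
    using that reval_Succ by (auto simp: length_Suc_conv)
  then show "recursive 1 (\<lambda>zs. Suc (zs ! 0))" unfolding recursive_def by blast
qed

lemma recursive_const: "recursive k (\<lambda>_. c)"
proof (induction c)
  case 0
  then show ?case unfolding recursive_def using reval_Zero by blast
next
  case (Suc c)
  then show ?case by (rule recursive_Suc)
qed

text \<open>One parameter \<open>a\<close> is enough, as several ones can be paired.\<close>

lemma recursive_rec_nat:
  assumes "recursive 1 (\<lambda>zs. b (zs ! 0))"
    and "recursive 3 (\<lambda>zs. g (zs ! 0) (zs ! 1) (zs ! 2))"
    and "recursive k n" "recursive k a"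
  shows "recursive k (\<lambda>xs. rec_nat (b (a xs)) (\<lambda>m y. g m y (a xs)) (n xs))"
proof (rule recursive_comp2[OF _ assms(3,4)])
  from assms obtain rb rg where rb: "\<And>xs. length xs = 1 \<Longrightarrow> reval rb xs (b (xs ! 0))"
    and rg: "\<And>xs. length xs = 3 \<Longrightarrow> reval rg xs (g (xs ! 0) (xs ! 1) (xs ! 2))"
    unfolding recursive_def by blast
  have "reval (RPrec rb rg) [m, x] (rec_nat (b x) (\<lambda>m y. g m y x) m)" for m x
  proof (induction m)
    case 0
    then show ?case using rb[of "[x]"] by (auto intro: reval_Prec_0)
  next
    case (Suc m)
    then show ?case
      using rg[of "[m, rec_nat (b x) (\<lambda>m y. g m y x) m, x]"] by (auto intro: reval_Prec_Suc)
  qed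
  then have "reval (RPrec rb rg) xs (rec_nat (b (xs ! 1)) (\<lambda>m y. g m y (xs ! 1)) (xs ! 0))"
    if "length xs = 2" for xs
    using that by (auto simp: length_Suc_conv numeral_2_eq_2)
  then show "recursive 2 (\<lambda>zs. rec_nat (b (zs ! 1)) (\<lambda>m y. g m y (zs ! 1)) (zs ! 0))"
    unfolding recursive_def by blast
qed

lemmas recursive_basic = recursive_Suc recursive_proj recursive_const

lemma recursive_add:
  assumes "recursive k f" "recursive k g"
  shows "recursive k (\<lambda>xs. f xs + g xs)"
proof -
  have "recursive k (\<lambda>xs. rec_nat (g xs) (\<lambda>_ y. Suc y) (f xs))"
    by (rule recursive_rec_nat[where g = "\<lambda>_ y _. Suc y" and b = "\<lambda>x. x"])
      (intro recursive_basic assms; simp)+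
  moreover have "rec_nat y (\<lambda>_ y. Suc y) x = x + y" for x y :: nat by (induction x) auto
  ultimately show ?thesis by simp
qed

lemma recursive_mult:
  assumes "recursive k f" "recursive k g"
  shows "recursive k (\<lambda>xs. f xs * g xs)"
proof -
  have "recursive k (\<lambda>xs. rec_nat 0 (\<lambda>_ y. g xs + y) (f xs))"
    by (rule recursive_rec_nat[where g = "\<lambda>_ y a. a + y" and b = "\<lambda>x. 0"])
      (intro recursive_basic recursive_add assms; simp)+
  moreover have "rec_nat 0 (\<lambda>_ z. y + z) x = x * y" for x y :: nat by (induction x) auto
  ultimately show ?thesis by simp
qed

lemma recursive_diff:
  assumes "recursive k f" "recursive k g"
  shows "recursive k (\<lambda>xs. f xs - g xs)"
proof -
  have "recursive k (\<lambda>xs. rec_nat 0 (\<lambda>m _. m) (f xs))" if "recursive k f" for k f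
    by (rule recursive_rec_nat[where g = "\<lambda>m _ _. m" and b = "\<lambda>x. 0" and a = "\<lambda>xs. 0"])
      (intro recursive_basic that; simp)+
  moreover have "rec_nat 0 (\<lambda>m _. m) x = x - 1" for x by (cases x) auto
  ultimately have pred: "recursive k (\<lambda>xs. f xs - 1)" if "recursive k f" for k f
    using that by simp
  have "recursive k (\<lambda>xs. rec_nat (f xs) (\<lambda>_ y. y - 1) (g xs))"
    by (rule recursive_rec_nat[where g = "\<lambda>_ y _. y - 1" and b = "\<lambda>x. x"])
      (intro recursive_basic pred assms; simp)+
  moreover have "rec_nat x (\<lambda>_ y. y - 1) y = x - y" for x y :: nat by (induction y) auto
  ultimately show ?thesis by simp
qed

lemma recursive_power:
  assumes "recursive k f" "recursive k g"
  shows "recursive k (\<lambda>xs. f xs ^ g xs)"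
proof -
  have "recursive k (\<lambda>xs. rec_nat 1 (\<lambda>_ y. f xs * y) (g xs))"
    by (rule recursive_rec_nat[where g = "\<lambda>_ y a. a * y" and b = "\<lambda>x. 1"])
      (intro recursive_basic recursive_mult assms; simp)+
  moreover have "rec_nat 1 (\<lambda>_ z. x * z) y = x ^ y" for x y :: nat by (induction y) auto
  ultimately show ?thesis by simp
qed

lemma recursive_if_eq:
  assumes "recursive k f" "recursive k g" "recursive k u" "recursive k v"
  shows "recursive k (\<lambda>xs. if f xs = g xs then u xs else v xs)"
proof -
  \<comment> \<open>In truncated subtraction \<open>(x - y) + (y - x)\<close> is the distance of
    \<open>x\<close> and \<open>y\<close>, so 1 minus it is the indicator of equality. Both branches
    are evaluated, which totality permits.\<close>
  have "(if x = y then a else b) = a * (1 - ((x - y) + (y - x))) + b * (1 - (1 - ((x - y) + (y - x))))"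
    for x y a b :: nat by auto
  then show ?thesis
    by (simp only:) (intro recursive_add recursive_mult recursive_diff recursive_const assms)
qed

lemma recursive_if_le:
  assumes "recursive k f" "recursive k g" "recursive k u" "recursive k v"
  shows "recursive k (\<lambda>xs. if f xs \<le> g xs then u xs else v xs)"
  using recursive_if_eq[OF recursive_diff[OF assms(1,2)] recursive_const[of _ 0] assms(3,4)] by simp

text \<open>The quotient grows by one exactly when the next dividend is the next multiple of the
  divisor. For divisor 0 this never happens and the result stays 0, as \<open>div\<close>
  requires.\<close>

lemma recursive_div:
  assumes "recursive k f" "recursive k g"
  shows "recursive k (\<lambda>xs. f xs div g xs)"
proof -
  have "recursive k (\<lambda>xs. rec_nat 0 (\<lambda>m y. if Suc m = g xs * Suc y then Suc y else y) (f xs))"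
    by (rule recursive_rec_nat[where g = "\<lambda>m y a. if Suc m = a * Suc y then Suc y else y" and b = "\<lambda>x. 0"])
      (intro recursive_basic recursive_if_eq recursive_mult assms; simp)+
  moreover have "rec_nat 0 (\<lambda>m z. if Suc m = d * Suc z then Suc z else z) x = x div d" for x d :: nat
  proof (induction x)
    case (Suc x)
    show ?case
    proof (cases "d = 0")
      case False
      have "Suc x = d * Suc (x div d) \<longleftrightarrow> Suc x mod d = 0"
      proof
        assume "Suc x = d * Suc (x div d)"
        then show "Suc x mod d = 0" by (metis mod_mult_self1_is_0)
      next
        assume "Suc x mod d = 0"
        then show "Suc x = d * Suc (x div d)"
          by (metis div_Suc mod_0_imp_dvd dvd_mult_div_cancel)
      qed
      then show ?thesis using Suc by (simp add: div_Suc)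
    qed (use Suc in simp)
  qed simp
  ultimately show ?thesis by simp
qed

lemma recursive_mod:
  assumes "recursive k f" "recursive k g"
  shows "recursive k (\<lambda>xs. f xs mod g xs)"
  unfolding minus_mult_div_eq_mod[symmetric]
  by (intro recursive_diff recursive_mult recursive_div assms)

lemma recursive_triangle:
  assumes "recursive k f"
  shows "recursive k (\<lambda>xs. triangle (f xs))"
  unfolding triangle_def by (intro recursive_basic recursive_mult recursive_div assms)

lemma recursive_prod_encode:
  assumes "recursive k f" "recursive k g"
  shows "recursive k (\<lambda>xs. prod_encode (f xs, g xs))"
  unfolding prod_encode_def by (simp, intro recursive_add recursive_triangle assms)

text \<open>The diagonal of the Cantor pairing on which \<open>z\<close> lies, that is the largest
  \<open>y\<close> with \<open>triangle y \<le> z\<close>; it advances whenever a triangular number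
  is reached.\<close>

definition diag :: "nat \<Rightarrow> nat" where
  "diag z = rec_nat 0 (\<lambda>m y. if Suc m = triangle (Suc y) then Suc y else y) z"

lemma diag: "triangle (diag z) \<le> z \<and> z < triangle (Suc (diag z))"
proof (induction z)
  case (Suc z)
  then show ?case by (auto simp: diag_def)
qed (simp add: diag_def)

lemma prod_decode_diag: "prod_decode z = (z - triangle (diag z), diag z - (z - triangle (diag z)))"
proof -
  have "z - triangle (diag z) \<le> diag z" using diag[of z] by auto
  then have "prod_encode (z - triangle (diag z), diag z - (z - triangle (diag z))) = z"
    using diag[of z] by (simp add: prod_encode_def)
  then show ?thesis by (metis prod_encode_inverse)
qed

lemma recursive_diag:
  assumes "recursive k f"
  shows "recursive k (\<lambda>xs. diag (f xs))"
  unfolding diag_def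
  by (rule recursive_rec_nat[where g = "\<lambda>m y a. if Suc m = triangle (Suc y) then Suc y else y"
        and b = "\<lambda>x. 0" and a = "\<lambda>xs. 0"])
    (intro recursive_basic recursive_if_eq recursive_triangle assms; simp)+

lemma recursive_prod_decode:
  assumes "recursive k f"
  shows "recursive k (\<lambda>xs. fst (prod_decode (f xs)))" "recursive k (\<lambda>xs. snd (prod_decode (f xs)))"
  unfolding prod_decode_diag fst_conv snd_conv
  by (intro recursive_diff recursive_triangle recursive_diag assms)+

text \<open>No length is stored and \<open>prod_encode (0, 0) = 0\<close>, so trailing zeros are
  lost; this is harmless as long as only positions inside the list are read.\<close>

primrec list_code :: "nat list \<Rightarrow> nat" where
  "list_code [] = 0"
| "list_code (x # xs) = prod_encode (x, list_code xs)"

definition code_nth :: "nat \<Rightarrow> nat \<Rightarrow> nat" where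
  "code_nth l i = fst (prod_decode (rec_nat l (\<lambda>_ l. snd (prod_decode l)) i))"

lemma code_nth_list_code: "i < length xs \<Longrightarrow> code_nth (list_code xs) i = xs ! i"
proof -
  \<comment> \<open>\<open>rec_nat\<close> peels off the last tail operation, whereas induction on
    the list needs the first one.\<close>
  have *: "rec_nat l (\<lambda>_ l. snd (prod_decode l)) (Suc i) =
      rec_nat (snd (prod_decode l)) (\<lambda>_ l. snd (prod_decode l)) i" for l i
    by (induction i) auto
  show "i < length xs \<Longrightarrow> code_nth (list_code xs) i = xs ! i"
  proof (induction xs arbitrary: i)
    case (Cons x xs)
    then show ?case
      by (cases i) (simp_all add: code_nth_def * del: nat.rec(2))
  qed simp
qed

lemma recursive_code_nth:
  assumes "recursive k f" "recursive k g"
  shows "recursive k (\<lambda>xs. code_nth (f xs) (g xs))"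
  unfolding code_nth_def
  by (rule recursive_prod_decode(1),
      rule recursive_rec_nat[where g = "\<lambda>m y a. snd (prod_decode y)" and b = "\<lambda>x. x"])
    (intro recursive_basic recursive_prod_decode assms; simp)+

lemmas recursive_intros = recursive_add recursive_mult recursive_diff recursive_power
  recursive_if_eq recursive_if_le recursive_div recursive_mod recursive_prod_encode
  recursive_prod_decode recursive_code_nth recursive_basic

section \<open>Loop programs over registers\<close>

datatype prog = Skip | Incr nat | Seq prog prog | Loop nat prog

text \<open>Decrement exists only as part of the loop test. On Goedel numbers a successful test is
  an exact division by a prime, which performs the decrement at the same time.\<close>

inductive exec :: "prog \<Rightarrow> (nat \<Rightarrow> nat) \<Rightarrow> (nat \<Rightarrow> nat) \<Rightarrow> bool" where
  exec_Skip: "exec Skip s s"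
| exec_Incr: "exec (Incr r) s (s(r := Suc (s r)))"
| exec_Seq: "exec p s s' \<Longrightarrow> exec q s' s'' \<Longrightarrow> exec (Seq p q) s s''"
| exec_Loop_0: "s r = 0 \<Longrightarrow> exec (Loop r p) s s"
| exec_Loop_Suc: "s r = Suc n \<Longrightarrow> exec p (s(r := n)) s' \<Longrightarrow> exec (Loop r p) s' s'' \<Longrightarrow>
    exec (Loop r p) s s''"

text \<open>\<open>S k\<close> is the store at the test after \<open>k\<close> rounds. The loop
  register only has to stay positive before the end, since a body may reload it, as the one for
  minimization does.\<close>

lemma exec_Loop_chain:
  assumes "\<And>k. k < n \<Longrightarrow> S k r > 0" and "S n r = 0"
    and "\<And>k. k < n \<Longrightarrow> exec p ((S k)(r := S k r - 1)) (S (Suc k))"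
  shows "exec (Loop r p) (S 0) (S n)"
proof -
  have "exec (Loop r p) (S (n - k)) (S n)" if "k \<le> n" for k
    using that
  proof (induction k)
    case 0
    then show ?case using assms(2) by (simp add: exec_Loop_0)
  next
    case (Suc k)
    let ?j = "n - Suc k"
    have j: "?j < n" "Suc ?j = n - k" using Suc.prems by auto
    show ?case
    proof (rule exec_Loop_Suc)
      show "S ?j r = Suc (S ?j r - 1)" using assms(1)[OF j(1)] by simp
      show "exec p ((S ?j)(r := S ?j r - 1)) (S (Suc ?j))" by (rule assms(3)[OF j(1)])
      show "exec (Loop r p) (S (Suc ?j)) (S n)" using Suc j(2) by simp
    qed
  qed
  from this[of n] show ?thesis by simp
qed

definition clear :: "nat \<Rightarrow> prog" where
  "clear r = Loop r Skip"

lemma exec_clear: "exec (clear r) s (s(r := 0))"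
proof -
  have "exec (Loop r Skip) (s(r := s r - 0)) (s(r := s r - s r))"
    by (rule exec_Loop_chain[of "s r" "\<lambda>k. s(r := s r - k)"]) (use exec_Skip in auto)
  then show ?thesis by (simp add: clear_def)
qed

definition move :: "nat \<Rightarrow> nat \<Rightarrow> prog" where
  "move a b = Loop a (Incr b)"

lemma exec_move:
  assumes "a \<noteq> b"
  shows "exec (move a b) s (s(a := 0, b := s b + s a))"
proof -
  have "exec (Loop a (Incr b)) (s(a := s a - 0, b := s b + 0)) (s(a := s a - s a, b := s b + s a))"
  proof (rule exec_Loop_chain[of "s a" "\<lambda>k. s(a := s a - k, b := s b + k)"])
    fix k assume "k < s a"
    show "exec (Incr b) ((s(a := s a - k, b := s b + k))(a := (s(a := s a - k, b := s b + k)) a - 1))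
       (s(a := s a - Suc k, b := s b + Suc k))"
      using exec_Incr[of b "s(a := s a - Suc k, b := s b + k)"] assms
      by (simp add: fun_upd_twist)
  qed (use assms in auto)
  then show ?thesis by (simp add: move_def)
qed

text \<open>A loop destroys the register it tests, hence the scratch register \<open>t\<close>, from
  which \<open>a\<close> is restored. The content of \<open>a\<close> is added to
  \<open>b\<close>.\<close>

definition copy :: "nat \<Rightarrow> nat \<Rightarrow> nat \<Rightarrow> prog" where
  "copy a b t = Seq (Loop a (Seq (Incr b) (Incr t))) (move t a)"

lemma exec_copy:
  assumes "a \<noteq> b" "t \<noteq> a" "t \<noteq> b" and t: "s t = 0"
  shows "exec (copy a b t) s (s(b := s b + s a))"
proof -
  let ?S = "\<lambda>k. s(a := s a - k, b := s b + k, t := k)"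
  have "exec (Loop a (Seq (Incr b) (Incr t))) (?S 0) (?S (s a))"
  proof (rule exec_Loop_chain[of "s a" ?S])
    fix k assume "k < s a"
    have "exec (Incr b) ((?S k)(a := ?S k a - 1)) (s(a := s a - Suc k, b := s b + Suc k, t := k))"
      using exec_Incr[of b "s(a := s a - Suc k, b := s b + k, t := k)"] assms
      by (simp add: fun_upd_twist)
    moreover have "exec (Incr t) (s(a := s a - Suc k, b := s b + Suc k, t := k)) (?S (Suc k))"
      using exec_Incr[of t "s(a := s a - Suc k, b := s b + Suc k, t := k)"] assms by simp
    ultimately show "exec (Seq (Incr b) (Incr t)) ((?S k)(a := ?S k a - 1)) (?S (Suc k))"
      by (rule exec_Seq)
  qed (use assms in auto)
  moreover have "?S 0 = s" using t by auto
  moreover have "exec (move t a) (?S (s a)) (s(b := s b + s a))"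
  proof -
    have "(?S (s a))(t := 0, a := ?S (s a) a + ?S (s a) t) = s(b := s b + s a)"
      using assms by (auto simp: fun_eq_iff)
    with exec_move[OF assms(2), of "?S (s a)"] show ?thesis by (simp only:)
  qed
  ultimately show ?thesis unfolding copy_def by (auto intro: exec_Seq)
qed

primrec seqs :: "prog list \<Rightarrow> prog" where
  "seqs [] = Skip"
| "seqs (p # ps) = Seq p (seqs ps)"

lemma exec_seqs:
  assumes "\<And>i. i < length ps \<Longrightarrow> exec (ps ! i) (S i) (S (Suc i))"
  shows "exec (seqs ps) (S 0) (S (length ps))"
  using assms
proof (induction ps arbitrary: S)
  case Nil
  then show ?case by (simp add: exec_Skip)
next
  case (Cons p ps)
  have "exec p (S 0) (S 1)" using Cons.prems[of 0] by simp
  moreover have "exec (seqs ps) (S (Suc 0)) (S (Suc (length ps)))"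
    using Cons.prems[of "Suc i" for i] by (intro Cons.IH[of "\<lambda>i. S (Suc i)"]) auto
  ultimately show ?case by (auto intro: exec_Seq)
qed

text \<open>
  In \<open>compile f as out b\<close> the arguments are read from the registers \<open>as\<close>, the result is written
  to \<open>out\<close>, and the registers from \<open>b\<close> on are work space: they have to be zero, and are zero again
  afterwards.
\<close>

primrec compile :: "recf \<Rightarrow> nat list \<Rightarrow> nat \<Rightarrow> nat \<Rightarrow> prog" where
  "compile RZero = (\<lambda>as out b. Skip)"
| "compile RSucc = (\<lambda>as out b. Seq (copy (hd as) out b) (Incr out))"
| "compile (RProj i) = (\<lambda>as out b. copy (as ! i) out b)"
| "compile (RComp f gs) = (\<lambda>as out b.
     let l = length gs in
     Seq (seqs (map (\<lambda>(i, c). c as (b + i) (b + l)) (zip [0..<l] (map compile gs))))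
       (Seq (compile f (map ((+) b) [0..<l]) out (b + l)) (seqs (map (\<lambda>i. clear (b + i)) [0..<l]))))"
| "compile (RPrec f g) = (\<lambda>as out b.
     Seq (copy (hd as) b (Suc b))
       (Seq (compile f (tl as) out (b + 3))
         (Seq (Loop b
             (Seq (compile g (Suc b # out # tl as) (b + 2) (b + 3))
               (Seq (clear out) (Seq (move (b + 2) out) (Incr (Suc b))))))
           (clear (Suc b)))))"
| "compile (RMin f) = (\<lambda>as out b.
     Seq (compile f (out # as) b (Suc b))
       (Loop b (Seq (clear b) (Seq (Incr out) (compile f (out # as) b (Suc b))))))"

text \<open>\<open>reval\<close> unwinds a primitive recursion from the top, while the compiled loop
  counts upwards; the sequence \<open>Y\<close> of intermediate values supplies the loop
  invariant.\<close>

lemma reval_Prec_chain: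
  assumes "reval (RPrec f g) (m # xs) z"
  shows "\<exists>Y. reval f xs (Y 0) \<and> (\<forall>i<m. reval g (i # Y i # xs) (Y (Suc i))) \<and> Y m = z"
  using assms
proof (induction m arbitrary: z)
  case 0
  then have "reval f xs z" by (rule reval_PrecE_0)
  then show ?case by (intro exI[of _ "\<lambda>_. z"]) auto
next
  case (Suc m)
  from Suc.prems obtain y where y: "reval (RPrec f g) (m # xs) y" "reval g (m # y # xs) z"
    by (rule reval_PrecE_Suc)
  from Suc.IH[OF y(1)] obtain Y where Y: "reval f xs (Y 0)"
    "\<And>i. i < m \<Longrightarrow> reval g (i # Y i # xs) (Y (Suc i))" "Y m = y" by blast
  show ?case
    by (intro exI[of _ "Y(Suc m := z)"]) (use Y y in \<open>auto simp: less_Suc_eq\<close>)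
qed

lemma exec_compile:
  assumes "reval f (map s as) z" "\<And>a. a \<in> set as \<Longrightarrow> a < b" "out < b" "out \<notin> set as"
    "s out = 0" "\<And>i. b \<le> i \<Longrightarrow> s i = 0"
  shows "exec (compile f as out b) s (s(out := z))"
  using assms
proof (induction f arbitrary: s as z out b)
  case RZero
  from RZero(1) have "z = 0" by (rule reval_ZeroE)
  with RZero have "s(out := z) = s" by auto
  then show ?case by (simp add: exec_Skip)
next
  case RSucc
  from RSucc.prems(1) obtain a where a: "as = [a]" "z = Suc (s a)"
    by (rule reval_SuccE) (auto simp: Cons_eq_map_conv)
  have "exec (copy a out b) s (s(out := s a))"
    using exec_copy[of a out b s] RSucc.prems a by auto
  moreover have "exec (Incr out) (s(out := s a)) (s(out := z))"
    using exec_Incr[of out "s(out := s a)"] a by simp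
  ultimately have "exec (Seq (copy a out b) (Incr out)) s (s(out := z))" by (rule exec_Seq)
  then show ?case by (simp only: compile.simps a list.sel)
next
  case (RProj i)
  from RProj.prems(1) have i: "i < length as" "z = s (as ! i)"
    by (auto elim: reval_ProjE)
  then have "as ! i \<in> set as" by simp
  with RProj.prems have "as ! i \<noteq> out" "b \<noteq> as ! i" "b \<noteq> out" "s b = 0" by fastforce+
  from exec_copy[of "as ! i" out b s, OF this]
  have "exec (copy (as ! i) out b) s (s(out := z))" using i(2) RProj.prems(5) by (simp only: add_0)
  then show ?case by (simp only: compile.simps)
next
  case (RComp f gs)
  let ?l = "length gs"
  from RComp.prems(1) obtain ys where
    ys: "list_all2 (\<lambda>g y. reval g (map s as) y) gs ys" "reval f ys z" by (rule reval_CompE)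
  have len: "length ys = ?l" using ys(1) by (simp add: list_all2_lengthD)
  \<comment> \<open>Store after \<open>k\<close> inner functions: their results fill the registers
    from \<open>b\<close> on.\<close>
  define S where "S = (\<lambda>k r. if b \<le> r \<and> r < b + k then ys ! (r - b) else s r)"
  let ?ps = "map (\<lambda>(i, c). c as (b + i) (b + ?l)) (zip [0..<?l] (map compile gs))"
  have Sas: "map (S i) as = map s as" for i
    using RComp.prems(2) by (fastforce simp: S_def)
  have "exec (seqs ?ps) (S 0) (S (length ?ps))"
  proof (rule exec_seqs)
    fix i assume "i < length ?ps"
    then have i: "i < ?l" by simp
    have "exec (compile (gs ! i) as (b + i) (b + ?l)) (S i) ((S i)(b + i := ys ! i))"
    proof (rule RComp.IH(2))
      show "gs ! i \<in> set gs" using i by simp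
      show "reval (gs ! i) (map (S i) as) (ys ! i)"
        using ys(1) i by (simp add: list_all2_conv_all_nth Sas)
      show "b + i \<notin> set as" using RComp.prems(2) by fastforce
    qed (use RComp.prems i in \<open>force simp: S_def\<close>)+
    moreover have "(S i)(b + i := ys ! i) = S (Suc i)"
      by (auto simp: S_def fun_eq_iff)
    ultimately show "exec (?ps ! i) (S i) (S (Suc i))" using i by simp
  qed
  moreover have "S 0 = s" by (auto simp: S_def)
  ultimately have 1: "exec (seqs ?ps) s (S ?l)" by simp
  have 2: "exec (compile f (map ((+) b) [0..<?l]) out (b + ?l)) (S ?l) ((S ?l)(out := z))"
  proof (rule RComp.IH(1))
    have "map (S ?l) (map ((+) b) [0..<?l]) = ys"
      by (rule nth_equalityI) (auto simp: S_def len)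
    then show "reval f (map (S ?l) (map ((+) b) [0..<?l])) z" using ys(2) by simp
  qed (use RComp.prems in \<open>auto simp: S_def\<close>)
  define S' where
    "S' = (\<lambda>k r. if b \<le> r \<and> r < b + k then 0 else if b \<le> r \<and> r < b + ?l then ys ! (r - b) else s r)"
  have "exec (seqs (map (\<lambda>i. clear (b + i)) [0..<?l])) ((S' 0)(out := z))
      ((S' (length (map (\<lambda>i. clear (b + i)) [0..<?l])))(out := z))"
  proof (rule exec_seqs[of _ "\<lambda>i. (S' i)(out := z)"])
    fix i assume "i < length (map (\<lambda>i. clear (b + i)) [0..<?l])"
    then have i: "i < ?l" by simp
    have "((S' i)(out := z))(b + i := 0) = (S' (Suc i))(out := z)"
      using RComp.prems i by (auto simp: S'_def fun_eq_iff)
    with exec_clear[of "b + i" "(S' i)(out := z)"] i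
    show "exec (map (\<lambda>i. clear (b + i)) [0..<?l] ! i) ((S' i)(out := z)) ((S' (Suc i))(out := z))"
      by simp
  qed
  moreover have "S' 0 = S ?l" by (auto simp: S'_def S_def)
  moreover have "S' ?l = s" using RComp.prems by (auto simp: S'_def)
  ultimately have 3: "exec (seqs (map (\<lambda>i. clear (b + i)) [0..<?l])) ((S ?l)(out := z)) (s(out := z))"
    by simp
  show ?case unfolding compile.simps Let_def by (rule exec_Seq[OF 1 exec_Seq[OF 2 3]])
next
  case (RPrec f g)
  have "as \<noteq> []"
    using RPrec.prems(1) by (auto elim: reval.cases)
  then obtain a as' where as: "as = a # as'" by (cases as) auto
  let ?xs = "map s as'"
  have "reval (RPrec f g) (s a # ?xs) z" using RPrec.prems(1) as by simp
  from reval_Prec_chain[OF this] obtain Y where Y: "reval f ?xs (Y 0)"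
    "\<And>i. i < s a \<Longrightarrow> reval g (i # Y i # ?xs) (Y (Suc i))" "Y (s a) = z" by blast
  have bnd: "a < b" "out < b" "a \<noteq> out" "\<And>c. c \<in> set as' \<Longrightarrow> c < b" "out \<notin> set as'" "s out = 0"
    using RPrec.prems as by auto
  have zero: "s i = 0" if "b \<le> i" for i using RPrec.prems that by simp
  \<comment> \<open>\<open>b\<close> holds the number of rounds left, \<open>Suc b\<close> the
    recursion index, \<open>out\<close> the value reached so far.\<close>
  define S where "S = (\<lambda>k. s(b := s a - k, Suc b := k, out := Y k))"
  have 1: "exec (copy a b (Suc b)) s (s(b := s a))"
    using exec_copy[of a b "Suc b" s] bnd zero by simp
  have "exec (compile f as' out (b + 3)) (s(b := s a)) ((s(b := s a))(out := Y 0))"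
  proof (rule RPrec.IH(1))
    have "map (s(b := s a)) as' = ?xs" using bnd by auto
    then show "reval f (map (s(b := s a)) as') (Y 0)" using Y(1) by (simp only:)
  qed (use bnd zero in \<open>auto dest: bnd(4)\<close>)
  moreover have "(s(b := s a))(out := Y 0) = S 0"
    using bnd zero by (auto simp: S_def fun_eq_iff)
  ultimately have 2: "exec (compile f as' out (b + 3)) (s(b := s a)) (S 0)" by simp
  let ?body = "Seq (compile g (Suc b # out # as') (b + 2) (b + 3))
               (Seq (clear out) (Seq (move (b + 2) out) (Incr (Suc b))))"
  have 3: "exec (Loop b ?body) (S 0) (S (s a))"
  proof (rule exec_Loop_chain)
    fix k assume k: "k < s a"
    let ?T = "s(b := s a - Suc k, Suc b := k, out := Y k)"
    have T: "(S k)(b := S k b - 1) = ?T" using bnd by (auto simp: S_def fun_eq_iff)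
    have b1: "exec (compile g (Suc b # out # as') (b + 2) (b + 3)) ?T (?T(b + 2 := Y (Suc k)))"
    proof (rule RPrec.IH(2))
      have "map ?T (Suc b # out # as') = k # Y k # ?xs"
        using bnd by (auto dest: bnd(4))
      then show "reval g (map ?T (Suc b # out # as')) (Y (Suc k))" using Y(2)[OF k] by (simp only:)
    qed (use bnd zero in \<open>auto dest: bnd(4)\<close>)
    have b2: "exec (clear out) (?T(b + 2 := Y (Suc k))) (?T(b + 2 := Y (Suc k), out := 0))"
      by (rule exec_clear)
    have "exec (move (b + 2) out) (?T(b + 2 := Y (Suc k), out := 0))
        (?T(b + 2 := 0, out := Y (Suc k)))"
      using exec_move[of "b + 2" out "?T(b + 2 := Y (Suc k), out := 0)"] bnd
      by (simp add: fun_upd_twist)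
    moreover have "?T(b + 2 := 0, out := Y (Suc k)) = ?T(out := Y (Suc k))"
      using bnd zero by (auto simp: fun_eq_iff)
    ultimately have b3: "exec (move (b + 2) out) (?T(b + 2 := Y (Suc k), out := 0))
        (?T(out := Y (Suc k)))" by simp
    have "(?T(out := Y (Suc k)))(Suc b := Suc ((?T(out := Y (Suc k))) (Suc b))) = S (Suc k)"
      using bnd by (auto simp: S_def fun_eq_iff)
    with exec_Incr[of "Suc b" "?T(out := Y (Suc k))"]
    have b4: "exec (Incr (Suc b)) (?T(out := Y (Suc k))) (S (Suc k))" by simp
    show "exec ?body ((S k)(b := S k b - 1)) (S (Suc k))"
      unfolding T by (rule exec_Seq[OF b1 exec_Seq[OF b2 exec_Seq[OF b3 b4]]])
  qed (use bnd in \<open>auto simp: S_def\<close>)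
  have "(S (s a))(Suc b := 0) = s(out := z)"
    using bnd zero Y(3) by (auto simp: S_def fun_eq_iff)
  with exec_clear[of "Suc b" "S (s a)"] have 4: "exec (clear (Suc b)) (S (s a)) (s(out := z))" by simp
  from exec_Seq[OF 1 exec_Seq[OF 2 exec_Seq[OF 3 4]]]
  show ?case by (simp only: compile.simps as list.sel)
next
  case (RMin f)
  from RMin.prems(1) have z: "reval f (z # map s as) 0" "\<forall>i<z. \<exists>y. reval f (i # map s as) (Suc y)"
    by (auto elim: reval_MinE)
  then obtain Y where Y: "\<And>i. i < z \<Longrightarrow> reval f (i # map s as) (Suc (Y i))" by metis
  \<comment> \<open>Value of \<open>f\<close> at each candidate; the 0 at \<open>z\<close> ends the
    loop. The register \<open>out\<close> itself serves as the search index.\<close>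
  define y where "y = (\<lambda>i. if i < z then Suc (Y i) else 0)"
  define S where "S = (\<lambda>k. s(out := k, b := y k))"
  have zero: "s i = 0" if "b \<le> i" for i using RMin.prems that by simp
  have run: "exec (compile f (out # as) b (Suc b)) (s(out := k)) (S k)" if "k \<le> z" for k
    unfolding S_def
  proof (rule RMin.IH)
    have "map (s(out := k)) (out # as) = k # map s as" using RMin.prems by auto
    moreover have "reval f (k # map s as) (y k)"
      using z Y that by (cases "k = z") (auto simp: y_def)
    ultimately show "reval f (map (s(out := k)) (out # as)) (y k)" by (simp only:)
  qed (use RMin.prems in force)+
  have "s(out := 0) = s" using RMin.prems by auto
  with run[of 0] have 1: "exec (compile f (out # as) b (Suc b)) s (S 0)" by simp
  have 2: "exec (Loop b (Seq (clear b) (Seq (Incr out) (compile f (out # as) b (Suc b))))) (S 0) (S z)"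
  proof (rule exec_Loop_chain)
    fix k assume k: "k < z"
    let ?T = "(S k)(b := S k b - 1)"
    have "?T(b := 0) = s(out := k)" using RMin.prems by (auto simp: S_def fun_eq_iff)
    with exec_clear[of b ?T] have 1: "exec (clear b) ?T (s(out := k))" by simp
    have 2: "exec (Incr out) (s(out := k)) (s(out := Suc k))"
      using exec_Incr[of out "s(out := k)"] by simp
    have 3: "exec (compile f (out # as) b (Suc b)) (s(out := Suc k)) (S (Suc k))"
      using run[of "Suc k"] k by simp
    show "exec (Seq (clear b) (Seq (Incr out) (compile f (out # as) b (Suc b)))) ?T (S (Suc k))"
      by (rule exec_Seq[OF 1 exec_Seq[OF 2 3]])
  qed (auto simp: S_def y_def)
  have "S z = s(out := z)" using RMin.prems by (auto simp: S_def y_def fun_eq_iff)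
  with exec_Seq[OF 1 2] show ?case by (simp only: compile.simps)
qed

section \<open>Two-counter machines\<close>

datatype instr = CHalt | CInc nat nat | CDec nat nat nat

text \<open>A halted configuration is a fixed point, so runs are iterates of a total function. In
  \<open>CDec i j m\<close> the label for zero comes first, matching the roles of \<open>j\<close>
  and \<open>m\<close> in \<open>c_dec i j m\<close>.\<close>

fun mnext :: "(nat \<Rightarrow> instr) \<Rightarrow> nat \<times> nat \<times> nat \<Rightarrow> nat \<times> nat \<times> nat" where
  "mnext M (p, x, y) = (case M p of
     CHalt \<Rightarrow> (p, x, y)
   | CInc i j \<Rightarrow> if i = 0 then (j, Suc x, y) else (j, x, Suc y)
   | CDec i j m \<Rightarrow>
       if i = 0 then if x = 0 then (j, x, y) else (m, x - 1, y)
       else if y = 0 then (j, x, y) else (m, x, y - 1))"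

definition reach :: "(nat \<Rightarrow> instr) \<Rightarrow> nat \<times> nat \<times> nat \<Rightarrow> nat \<times> nat \<times> nat \<Rightarrow> bool" where
  "reach M c c' \<longleftrightarrow> (\<exists>t. (mnext M ^^ t) c = c')"

definition halts :: "(nat \<Rightarrow> instr) \<Rightarrow> nat \<times> nat \<times> nat \<Rightarrow> bool" where
  "halts M c \<longleftrightarrow> (\<exists>t. M (fst ((mnext M ^^ t) c)) = CHalt)"

lemma reach_refl: "reach M c c"
  unfolding reach_def by (rule exI[of _ 0]) simp

lemma reach_step: "mnext M c = c1 \<Longrightarrow> reach M c1 c' \<Longrightarrow> reach M c c'"
  unfolding reach_def by (metis comp_apply funpow_Suc_right)

lemma reach_trans: "reach M c c1 \<Longrightarrow> reach M c1 c2 \<Longrightarrow> reach M c c2"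
  unfolding reach_def by (metis comp_apply funpow_add)

lemma mnext_halted: "M (fst c) = CHalt \<Longrightarrow> mnext M c = c"
  by (cases c) simp

lemma halts_mnext: "halts M (mnext M c) \<longleftrightarrow> halts M c"
proof
  assume "halts M (mnext M c)"
  then obtain t where "M (fst ((mnext M ^^ t) (mnext M c))) = CHalt" by (auto simp: halts_def)
  then have "M (fst ((mnext M ^^ Suc t) c)) = CHalt" by (simp only: funpow_Suc_right comp_apply)
  then show "halts M c" unfolding halts_def by blast
next
  assume "halts M c"
  then obtain t where "M (fst ((mnext M ^^ t) c)) = CHalt" by (auto simp: halts_def)
  then have "M (fst ((mnext M ^^ Suc t) c)) = CHalt" by (simp add: mnext_halted)
  then have "M (fst ((mnext M ^^ t) (mnext M c))) = CHalt" by (simp only: funpow_Suc_right comp_apply)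
  then show "halts M (mnext M c)" unfolding halts_def by blast
qed

lemma reach_halts:
  assumes "reach M c c'"
  shows "halts M c \<longleftrightarrow> halts M c'"
proof -
  have "halts M ((mnext M ^^ t) c) \<longleftrightarrow> halts M c" for t
    by (induction t) (simp_all add: halts_mnext)
  with assms show ?thesis by (auto simp: reach_def)
qed

lemma halts_CHalt: "M p = CHalt \<Longrightarrow> halts M (p, x, y)"
  unfolding halts_def by (rule exI[of _ 0]) simp

lemma not_halts_self_loop:
  assumes "M p = CInc i p"
  shows "\<not> halts M (p, x, y)"
proof -
  have "fst ((mnext M ^^ t) (p, x, y)) = p" for t
  proof (induction t)
    case (Suc t)
    then show ?case using assms by (cases "(mnext M ^^ t) (p, x, y)") simp
  qed simp
  with assms show ?thesis by (simp add: halts_def)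
qed

section \<open>Machine code that multiplies and divides by constants\<close>

definition code_at :: "(nat \<Rightarrow> instr) \<Rightarrow> nat \<Rightarrow> instr list \<Rightarrow> bool" where
  "code_at M off L \<longleftrightarrow> (\<forall>i<length L. M (off + i) = L ! i)"

lemma code_at_append:
  "code_at M off (L @ L') \<longleftrightarrow> code_at M off L \<and> code_at M (off + length L) L'"
proof -
  have "(\<forall>i<length L + length L'. P i) \<longleftrightarrow> (\<forall>i<length L. P i) \<and> (\<forall>i<length L'. P (length L + i))"
    for P :: "nat \<Rightarrow> bool"
  proof safe
    fix i assume "\<forall>i<length L. P i" "\<forall>i<length L'. P (length L + i)" "i < length L + length L'"
    then show "P i" by (cases "i < length L") (auto dest: spec[of _ "i - length L"])
  qed auto
  from this[of "\<lambda>i. M (off + i) = (L @ L') ! i"] show ?thesis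
    by (simp add: code_at_def nth_append add.assoc)
qed

lemma code_at_Cons: "code_at M off (x # L) \<longleftrightarrow> M off = x \<and> code_at M (Suc off) L"
  using code_at_append[of M off "[x]" L] by (simp add: code_at_def)

lemma code_at_map: "code_at M off (map f [0..<k]) \<longleftrightarrow> (\<forall>t<k. M (off + t) = f t)"
  by (simp add: code_at_def)

text \<open>For each unit of counter 0 the chain of increments is entered at its end
  \<open>off + k\<close> and falls back to \<open>off\<close>, adding \<open>k\<close> to counter 1;
  the last two instructions move counter 1 back to counter 0.\<close>

definition mulcode :: "nat \<Rightarrow> nat \<Rightarrow> nat \<Rightarrow> instr list" where
  "mulcode k off ext = CDec 0 (off + k + 1) (off + k) # map (\<lambda>t. CInc 1 (off + t)) [0..<k]
     @ [CDec 1 ext (off + k + 2), CInc 0 (off + k + 1)]"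

lemma length_mulcode: "length (mulcode k off ext) = k + 3"
  by (simp add: mulcode_def)

lemma reach_move:
  assumes "M p = CDec 1 ext q" "M q = CInc 0 p"
  shows "reach M (p, x, y) (ext, x + y, 0)"
proof (induction y arbitrary: x)
  case 0
  show ?case by (rule reach_step[OF _ reach_refl]) (use assms in simp)
next
  case (Suc y)
  have "mnext M (p, x, Suc y) = (q, x, y)" "mnext M (q, x, y) = (p, Suc x, y)"
    using assms by simp_all
  moreover have "reach M (p, Suc x, y) (ext, x + Suc y, 0)" using Suc[of "Suc x"] by simp
  ultimately show ?case using reach_step by metis
qed

lemma reach_mulcode:
  assumes "code_at M off (mulcode k off ext)"
  shows "reach M (off, x, 0) (ext, k * x, 0)"
proof -
  have M: "M off = CDec 0 (off + k + 1) (off + k)" "M (off + k + 1) = CDec 1 ext (off + k + 2)"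
    "M (off + k + 2) = CInc 0 (off + k + 1)" and chain: "\<And>t. t < k \<Longrightarrow> M (Suc (off + t)) = CInc 1 (off + t)"
  proof -
    have 1: "M off = CDec 0 (off + k + 1) (off + k)"
      and 2: "code_at M (Suc off) (map (\<lambda>t. CInc 1 (off + t)) [0..<k])"
      and 3: "code_at M (Suc off + k) [CDec 1 ext (off + k + 2), CInc 0 (off + k + 1)]"
      using assms unfolding mulcode_def code_at_append code_at_Cons by simp_all
    show "M off = CDec 0 (off + k + 1) (off + k)" by (rule 1)
    show "M (off + k + 1) = CDec 1 ext (off + k + 2)" "M (off + k + 2) = CInc 0 (off + k + 1)"
      using 3 by (simp_all add: code_at_Cons)
    show "M (Suc (off + t)) = CInc 1 (off + t)" if "t < k" for t
      using 2 that by (simp add: code_at_map)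
  qed
  have up: "reach M (off + t, x, y) (off, x, y + t)" if "t \<le> k" for t x y
    using that
  proof (induction t arbitrary: y)
    case 0
    then show ?case by (simp add: reach_refl)
  next
    case (Suc t)
    show ?case by (rule reach_step[OF refl]) (use chain[of t] Suc.prems Suc.IH[of "Suc y"] in simp)
  qed
  have "reach M (off, x, y) (off + k + 1, 0, y + k * x)" for y
  proof (induction x arbitrary: y)
    case 0
    show ?case by (rule reach_step[OF _ reach_refl]) (use M in simp)
  next
    case (Suc x)
    have "reach M (off, Suc x, y) (off, x, y + k)"
      by (rule reach_step[OF refl]) (use up[of k x y] M in simp)
    from reach_trans[OF this Suc[of "y + k"]] show ?case by (simp add: algebra_simps)
  qed
  from reach_trans[OF this[of 0] reach_move[OF M(2,3)]] show ?thesis by simp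
qed

text \<open>
  The remainder found by repeated subtraction is remembered in the program counter: the chain of
  increments at the end is entered at the position of the remainder.
\<close>

definition divcode :: "nat \<Rightarrow> nat \<Rightarrow> nat \<Rightarrow> nat \<Rightarrow> instr list" where
  "divcode k off A B =
     map (\<lambda>t. CDec 0 (if t = 0 then off + k + 1 else off + k + 3 + t) (off + t + 1)) [0..<k]
     @ [CInc 1 off, CDec 1 A (off + k + 2), CInc 0 (off + k + 1), CDec 1 B (off + 2 * k + 3)]
     @ map (\<lambda>s. CInc 0 (off + k + 3 + s)) [0..<k]"

lemma length_divcode: "length (divcode k off A B) = 2 * k + 4"
  by (simp add: divcode_def)

text \<open>Let \<open>x = k * q + t\<close> with \<open>t < k\<close>. After \<open>q\<close>
  rounds the counters hold \<open>t\<close> and \<open>q\<close>, so the chain of decrements gets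
  stuck at position \<open>t\<close>. If \<open>t = 0\<close>, counter 1 already is the quotient;
  otherwise \<open>x\<close> is rebuilt by adding \<open>t\<close> once and then \<open>k\<close>
  for each unit of counter 1.\<close>

lemma reach_divcode:
  assumes "code_at M off (divcode k off A B)" and k: "k > 0"
  shows "k dvd x \<Longrightarrow> reach M (off, x, 0) (A, x div k, 0)"
    and "\<not> k dvd x \<Longrightarrow> reach M (off, x, 0) (B, x, 0)"
proof -
  have M: "M (off + k) = CInc 1 off" "M (off + k + 1) = CDec 1 A (off + k + 2)"
    "M (off + k + 2) = CInc 0 (off + k + 1)" "M (off + k + 3) = CDec 1 B (off + 2 * k + 3)"
    and dn: "\<And>t. t < k \<Longrightarrow>
      M (off + t) = CDec 0 (if t = 0 then off + k + 1 else off + k + 3 + t) (off + t + 1)"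
    and up: "\<And>s. s < k \<Longrightarrow> M (off + k + 3 + Suc s) = CInc 0 (off + k + 3 + s)"
  proof -
    have 1: "code_at M off (map (\<lambda>t. CDec 0 (if t = 0 then off + k + 1 else off + k + 3 + t)
        (off + t + 1)) [0..<k])"
      and 2: "code_at M (off + k)
        [CInc 1 off, CDec 1 A (off + k + 2), CInc 0 (off + k + 1), CDec 1 B (off + 2 * k + 3)]"
      and 3: "code_at M (off + k + 4) (map (\<lambda>s. CInc 0 (off + k + 3 + s)) [0..<k])"
      using assms(1) unfolding divcode_def code_at_append by (simp_all add: eval_nat_numeral)
    show "M (off + k) = CInc 1 off" "M (off + k + 1) = CDec 1 A (off + k + 2)"
      "M (off + k + 2) = CInc 0 (off + k + 1)" "M (off + k + 3) = CDec 1 B (off + 2 * k + 3)"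
      using 2 by (simp_all add: code_at_Cons numeral_3_eq_3)
    show "M (off + t) = CDec 0 (if t = 0 then off + k + 1 else off + k + 3 + t) (off + t + 1)"
      if "t < k" for t using 1 that by (simp add: code_at_map)
    have "off + k + 4 + s = off + k + 3 + Suc s" for s by simp
    then show "M (off + k + 3 + Suc s) = CInc 0 (off + k + 3 + s)" if "s < k" for s
      using 3 that unfolding code_at_map by metis
  qed
  have dn': "reach M (off, x + t, y) (off + t, x, y)" if "t \<le> k" for t x y
    using that
  proof (induction t arbitrary: x)
    case 0
    then show ?case by (simp add: reach_refl)
  next
    case (Suc t)
    have "reach M (off, Suc x + t, y) (off + t, Suc x, y)" using Suc.prems by (intro Suc.IH) simp
    moreover have "reach M (off + t, Suc x, y) (off + Suc t, x, y)"
      by (rule reach_step[OF _ reach_refl]) (use dn[of t] Suc.prems in simp)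
    ultimately have "reach M (off, Suc x + t, y) (off + Suc t, x, y)" by (rule reach_trans)
    then show ?case by simp
  qed
  have sub: "reach M (off, k * q + t, y) (off, t, y + q)" for q t y
  proof (induction q arbitrary: y)
    case 0
    then show ?case by (simp add: reach_refl)
  next
    case (Suc q)
    have "reach M (off, k * q + t + k, y) (off + k, k * q + t, y)" by (rule dn') simp
    moreover have "reach M (off + k, k * q + t, y) (off, k * q + t, Suc y)"
      by (rule reach_step[OF _ reach_refl]) (use M in simp)
    ultimately have "reach M (off, k * q + t + k, y) (off, k * q + t, Suc y)" by (rule reach_trans)
    from reach_trans[OF this Suc[of "Suc y"]] show ?case by (simp add: algebra_simps)
  qed
  have up': "reach M (off + k + 3 + s, x, y) (off + k + 3, x + s, y)" if "s \<le> k" for s x y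
    using that
  proof (induction s arbitrary: x)
    case 0
    then show ?case by (simp add: reach_refl)
  next
    case (Suc s)
    show ?case
      by (rule reach_step[OF refl]) (use up[of s] Suc.prems Suc.IH[of "Suc x"] in simp)
  qed
  have add: "reach M (off + k + 3, x, y) (B, x + k * y, 0)" for x y
  proof (induction y arbitrary: x)
    case 0
    show ?case by (rule reach_step[OF _ reach_refl]) (use M in simp)
  next
    case (Suc y)
    have "mnext M (off + k + 3, x, Suc y) = (off + k + 3 + k, x, y)" using M by simp
    moreover have "reach M (off + k + 3 + k, x, y) (off + k + 3, x + k, y)" by (rule up') simp
    ultimately have "reach M (off + k + 3, x, Suc y) (off + k + 3, x + k, y)" by (rule reach_step)
    from reach_trans[OF this Suc[of "x + k"]] show ?case by (simp add: algebra_simps)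
  qed
  let ?q = "x div k" and ?t = "x mod k"
  have x: "reach M (off, x, 0) (off, ?t, ?q)" using sub[of ?q ?t 0] by simp
  show "reach M (off, x, 0) (A, x div k, 0)" if "k dvd x"
  proof -
    have "mnext M (off, ?t, ?q) = (off + k + 1, 0, ?q)" using that dn[of 0] k by simp
    then have "reach M (off, ?t, ?q) (A, 0 + ?q, 0)" by (rule reach_step) (rule reach_move[OF M(2,3)])
    with reach_trans[OF x] show ?thesis by simp
  qed
  show "reach M (off, x, 0) (B, x, 0)" if "\<not> k dvd x"
  proof -
    have t: "0 < ?t" "?t < k" using that k by (auto simp: dvd_eq_mod_eq_0)
    have 1: "reach M (off, ?t, ?q) (off + ?t, 0, ?q)" using dn'[of ?t 0 ?q] t by simp
    have 2: "reach M (off + ?t, 0, ?q) (off + k + 3 + ?t, 0, ?q)"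
      by (rule reach_step[OF _ reach_refl]) (use dn[of ?t] t in simp)
    have 3: "reach M (off + k + 3 + ?t, 0, ?q) (off + k + 3, ?t, ?q)"
      using up'[of ?t 0 ?q] t by simp
    show ?thesis
      using reach_trans[OF x reach_trans[OF 1 reach_trans[OF 2 reach_trans[OF 3 add]]]] by simp
  qed
qed

section \<open>Goedel numbering of register contents\<close>

definition prm :: "nat \<Rightarrow> nat" where
  "prm = enumerate {p. prime p}"

lemma prime_prm: "prime (prm r)"
  using enumerate_in_set[OF primes_infinite, of r] unfolding prm_def by blast

lemma prm_inject: "prm r = prm r' \<longleftrightarrow> r = r'"
  unfolding prm_def by (rule strict_mono_eq[OF strict_mono_enumerate[OF primes_infinite]])

lemma prm_pos: "prm r > 0"
  by (rule prime_gt_0_nat[OF prime_prm])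

definition goedel :: "nat \<Rightarrow> (nat \<Rightarrow> nat) \<Rightarrow> nat" where
  "goedel K s = (\<Prod>r<K. prm r ^ s r)"

lemma goedel_Suc:
  assumes "r < K"
  shows "goedel K (s(r := Suc n)) = prm r * goedel K (s(r := n))"
proof -
  have "goedel K (s(r := m)) = prm r ^ m * (\<Prod>r'\<in>{..<K} - {r}. prm r' ^ s r')" for m
  proof -
    have "goedel K (s(r := m)) = prm r ^ m * (\<Prod>r'\<in>{..<K} - {r}. prm r' ^ (s(r := m)) r')"
      unfolding goedel_def using assms prod.remove[of "{..<K}" r "\<lambda>r'. prm r' ^ (s(r := m)) r'"] by simp
    also have "(\<Prod>r'\<in>{..<K} - {r}. prm r' ^ (s(r := m)) r') = (\<Prod>r'\<in>{..<K} - {r}. prm r' ^ s r')"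
      by (rule prod.cong) auto
    finally show ?thesis .
  qed
  note * = this
  show ?thesis by (simp only: *[of "Suc n"] *[of n] power_Suc mult.assoc)
qed

lemma prm_dvd_goedel:
  assumes "r < K"
  shows "prm r dvd goedel K s \<longleftrightarrow> s r > 0"
proof
  assume "prm r dvd goedel K s"
  then obtain r' where r': "prm r dvd prm r' ^ s r'"
    using prime_dvd_prod_iff[OF finite_lessThan prime_prm, of r "\<lambda>r. prm r ^ s r" K]
    unfolding goedel_def by blast
  then have "prm r dvd prm r'" by (rule prime_dvd_power[OF prime_prm])
  then have "prm r = prm r'" by (rule primes_dvd_imp_eq[OF prime_prm prime_prm])
  then have "r = r'" by (simp only: prm_inject)
  moreover have "s r' \<noteq> 0"
  proof
    assume "s r' = 0"
    with r' have "prm r = 1" by simp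
    with prime_prm[of r] show False by simp
  qed
  ultimately show "s r > 0" by simp
next
  assume "s r > 0"
  then have "prm r dvd prm r ^ s r" by (rule dvd_power[OF disjI1])
  also have "\<dots> dvd goedel K s" unfolding goedel_def by (rule dvd_prodI) (use assms in auto)
  finally show "prm r dvd goedel K s" .
qed

section \<open>Translation of loop programs into machine code\<close>

primrec regs :: "prog \<Rightarrow> nat set" where
  "regs Skip = {}"
| "regs (Incr r) = {r}"
| "regs (Seq p q) = regs p \<union> regs q"
| "regs (Loop r p) = insert r (regs p)"

lemma finite_regs: "finite (regs p)"
  by (induction p) auto

primrec plen :: "prog \<Rightarrow> nat" where
  "plen Skip = 4"
| "plen (Incr r) = prm r + 3"
| "plen (Seq p q) = plen p + plen q"
| "plen (Loop r p) = 2 * prm r + 4 + plen p"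

text \<open>Incrementing a register is multiplication by its prime, and a loop test is division that
  leaves to \<open>ext\<close> if it fails. \<open>Skip\<close> multiplies by 1, so that every
  program has code that reaches \<open>ext\<close> by a jump.\<close>

primrec pcode :: "prog \<Rightarrow> nat \<Rightarrow> nat \<Rightarrow> instr list" where
  "pcode Skip = mulcode 1"
| "pcode (Incr r) = mulcode (prm r)"
| "pcode (Seq p q) = (\<lambda>off ext. pcode p off (off + plen p) @ pcode q (off + plen p) ext)"
| "pcode (Loop r p) = (\<lambda>off ext.
     divcode (prm r) off (off + 2 * prm r + 4) ext @ pcode p (off + 2 * prm r + 4) off)"

lemma length_pcode: "length (pcode p off ext) = plen p"
  by (induction p arbitrary: off ext) (simp_all add: length_mulcode length_divcode)

lemma reach_pcode:
  assumes "exec p s s'" "regs p \<subseteq> {..<K}" "code_at M off (pcode p off ext)"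
  shows "reach M (off, goedel K s, 0) (ext, goedel K s', 0)"
  using assms
proof (induction arbitrary: off ext rule: exec.induct)
  case (exec_Skip s)
  then show ?case using reach_mulcode[of M off 1 ext] by simp
next
  case (exec_Incr r s)
  then have "goedel K (s(r := Suc (s r))) = prm r * goedel K s"
    and "code_at M off (mulcode (prm r) off ext)"
    using goedel_Suc[of r K s "s r"] by simp_all
  with reach_mulcode[of M off "prm r" ext "goedel K s"] show ?case by (simp only:)
next
  case (exec_Seq p s s' q s'')
  then have "reach M (off, goedel K s, 0) (off + plen p, goedel K s', 0)"
    "reach M (off + plen p, goedel K s', 0) (ext, goedel K s'', 0)"
    by (simp_all add: code_at_append length_pcode)
  then show ?case by (rule reach_trans)
next
  case (exec_Loop_0 s r p)
  then have "code_at M off (divcode (prm r) off (off + 2 * prm r + 4) ext)"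
    and "\<not> prm r dvd goedel K s"
    using prm_dvd_goedel[of r K s] by (simp_all add: code_at_append)
  then show ?case by (rule reach_divcode(2)[OF _ prm_pos])
next
  case (exec_Loop_Suc s r n p s' s'')
  let ?off = "off + 2 * prm r + 4"
  have r: "r < K" and dv: "code_at M off (divcode (prm r) off ?off ext)"
    and bd: "code_at M ?off (pcode p ?off off)"
    using exec_Loop_Suc.prems by (auto simp: code_at_append length_divcode add.assoc)
  have "s = s(r := Suc n)" using exec_Loop_Suc.hyps(1) by auto
  then have g: "goedel K s = prm r * goedel K (s(r := n))" using goedel_Suc[OF r] by metis
  then have "reach M (off, goedel K s, 0) (?off, goedel K (s(r := n)), 0)"
    using reach_divcode(1)[OF dv prm_pos, of "goedel K s"] prm_pos[of r] by simp
  moreover have "reach M (?off, goedel K (s(r := n)), 0) (off, goedel K s', 0)"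
    by (rule exec_Loop_Suc.IH(1)[OF _ bd]) (use exec_Loop_Suc.prems(1) in simp)
  moreover have "reach M (off, goedel K s', 0) (ext, goedel K s'', 0)"
    using exec_Loop_Suc.IH(2) exec_Loop_Suc.prems by (simp only:)
  ultimately show ?case by (rule reach_trans[OF reach_trans])
qed

primrec labels :: "instr \<Rightarrow> nat set" where
  "labels CHalt = {}"
| "labels (CInc i j) = {j}"
| "labels (CDec i j m) = {j, m}"

primrec counters :: "instr \<Rightarrow> nat set" where
  "counters CHalt = {}"
| "counters (CInc i j) = {i}"
| "counters (CDec i j m) = {i}"

definition wf_instr :: "nat \<Rightarrow> instr \<Rightarrow> bool" where
  "wf_instr n c \<longleftrightarrow> labels c \<subseteq> {..n} \<and> counters c \<subseteq> {0, 1}"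

lemma wf_mulcode:
  "c \<in> set (mulcode k off ext) \<Longrightarrow> off + k + 2 \<le> n \<Longrightarrow> ext \<le> n \<Longrightarrow> wf_instr n c"
  by (auto simp: mulcode_def wf_instr_def simp del: upt_Suc)

lemma wf_divcode:
  "c \<in> set (divcode k off A B) \<Longrightarrow> off + 2 * k + 3 \<le> n \<Longrightarrow> A \<le> n \<Longrightarrow> B \<le> n \<Longrightarrow> wf_instr n c"
  by (auto simp: divcode_def wf_instr_def simp del: upt_Suc)

lemma wf_pcode:
  "c \<in> set (pcode p off ext) \<Longrightarrow> off + plen p \<le> n \<Longrightarrow> ext \<le> n \<Longrightarrow> wf_instr n c"
proof (induction p arbitrary: off ext)
  case Skip
  then show ?case using wf_mulcode[of c 1 off ext n] by simp
next
  case (Incr r)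
  then show ?case using wf_mulcode[of c "prm r" off ext n] by simp
next
  case (Seq p q)
  from Seq.prems(1) consider "c \<in> set (pcode p off (off + plen p))"
    | "c \<in> set (pcode q (off + plen p) ext)" by auto
  then show ?case
  proof cases
    case 1
    show ?thesis by (rule Seq.IH(1)[OF 1]) (use Seq.prems in simp_all)
  next
    case 2
    show ?thesis by (rule Seq.IH(2)[OF 2]) (use Seq.prems in simp_all)
  qed
next
  case (Loop r p)
  from Loop.prems(1) consider "c \<in> set (divcode (prm r) off (off + 2 * prm r + 4) ext)"
    | "c \<in> set (pcode p (off + 2 * prm r + 4) off)" by auto
  then show ?case
  proof cases
    case 1
    show ?thesis by (rule wf_divcode[OF 1]) (use Loop.prems in simp_all)
  next
    case 2
    show ?thesis by (rule Loop.IH[OF 2]) (use Loop.prems in simp_all)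
  qed
qed

section \<open>Machine instructions as computations\<close>

lemma fresh_binder_id: "(\<And>y. y \<in> A \<Longrightarrow> y \<noteq> x \<Longrightarrow> x \<notin> fv_val (\<sigma> y)) \<Longrightarrow> fresh_binder \<sigma> x A = x"
  by (auto simp: fresh_binder_def Let_def)

lemma finite_fv: "finite (fv_val v)" "finite (fv_comp c)" "finite (fv_handler h)"
  by (induction v and c and h) auto

text \<open>Terms are not identified up to renaming, so this equality rests on
  \<open>fresh_binder\<close> keeping a name unless a capture threatens.\<close>

lemma subst_id:
  "(\<And>x. x \<in> fv_val v \<Longrightarrow> \<sigma> x = Var x) \<Longrightarrow> subst_val \<sigma> v = v"
  "(\<And>x. x \<in> fv_comp c \<Longrightarrow> \<sigma> x = Var x) \<Longrightarrow> subst_comp \<sigma> c = c"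
  "(\<And>x. x \<in> fv_handler h \<Longrightarrow> \<sigma> x = Var x) \<Longrightarrow> subst_handler \<sigma> h = h"
proof (induction v and c and h arbitrary: \<sigma> and \<sigma> and \<sigma>)
  case (Lam x c)
  have "fresh_binder \<sigma> x (fv_comp c) = x" by (rule fresh_binder_id) (use Lam.prems in auto)
  then show ?case using Lam by (simp add: Let_def)
next
  case (Rec x v)
  have "fresh_binder \<sigma> x (fv_val v) = x" by (rule fresh_binder_id) (use Rec.prems in auto)
  then show ?case using Rec by (simp add: Let_def)
next
  case (LetIn x c d)
  have "fresh_binder \<sigma> x (fv_comp d) = x" by (rule fresh_binder_id) (use LetIn.prems in auto)
  then show ?case using LetIn by (simp add: Let_def)
next
  case (HReturn x c)
  have "fresh_binder \<sigma> x (fv_comp c) = x" by (rule fresh_binder_id) (use HReturn.prems in auto)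
  then show ?case using HReturn by (simp add: Let_def)
next
  case (HOp opn x k c h)
  have 1: "fresh_binder \<sigma> x (fv_comp c - {k}) = x"
    by (rule fresh_binder_id) (use HOp.prems in auto)
  have "fresh_binder (\<sigma>(x := Var x)) k (fv_comp c) = k"
    by (rule fresh_binder_id) (use HOp.prems in auto)
  with 1 show ?case using HOp by (simp add: Let_def)
qed auto

text \<open>Such a substitution can never capture, so no binder is renamed. Reduction of the
  simulating programs produces only substitutions of this kind; the expansion of \<open>mrec\<close>
  in general does not.\<close>

definition closing :: "(var \<Rightarrow> val) \<Rightarrow> bool" where
  "closing \<sigma> \<longleftrightarrow> (\<forall>y. \<sigma> y = Var y \<or> fv_val (\<sigma> y) = {})"

lemma closing_Var: "closing Var"
  by (simp add: closing_def)

lemma closing_upd_Var: "closing \<sigma> \<Longrightarrow> closing (\<sigma>(x := Var x))"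
  by (simp add: closing_def)

lemma closing_upd: "closing \<sigma> \<Longrightarrow> fv_val v = {} \<Longrightarrow> closing (\<sigma>(x := v))"
  by (simp add: closing_def)

lemma fresh_binder_closing:
  assumes "closing \<sigma>"
  shows "fresh_binder \<sigma> x A = x"
proof (rule fresh_binder_id)
  fix y assume "y \<noteq> x"
  with assms show "x \<notin> fv_val (\<sigma> y)" by (metis closing_def empty_iff fv_val.simps(1) singletonD)
qed

lemma subst_closed: "fv_val v = {} \<Longrightarrow> subst_val \<sigma> v = v"
  by (rule subst_id(1)) simp

definition call_val :: "val \<Rightarrow> comp" where
  "call_val u = app2 u (Var (xvar 0)) (Var (xvar 1))"

text \<open>The bodies of \<open>Inst\<close> with arbitrary values \<open>\<tau> j\<close> in place
  of the function variables, since after unfolding different copies of a function occur at its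
  labels.\<close>

primrec inst_comp :: "instr \<Rightarrow> (nat \<Rightarrow> val) \<Rightarrow> comp" where
  "inst_comp CHalt \<tau> = Return Unit"
| "inst_comp (CInc i j) \<tau> =
     LetIn (xvar i) (Return (Lam vy (Op succ_op (Var (xvar i))))) (call_val (\<tau> j))"
| "inst_comp (CDec i j m) \<tau> =
     Handle (HOp succ_op (xvar i) vk (call_val (\<tau> m)) (HReturn vx (call_val (\<tau> j))))
       (App (Var (xvar i)) Unit)"

definition fn_val :: "instr \<Rightarrow> (nat \<Rightarrow> val) \<Rightarrow> val" where
  "fn_val c \<tau> = Lam (xvar 0) (Return (Lam (xvar 1) (inst_comp c \<tau>)))"

lemma inst_comp_Inst:
  assumes "wf_instr n c"
  shows "inst_comp c (\<lambda>j. Var (fvar j)) \<in> Inst n"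
  using assms by (cases c) (auto simp: wf_instr_def Inst_def call_val_def call_def c_inc_def c_dec_def)

lemmas var_defs = xvar_def vx_def vy_def vk_def vw_def vz_def

lemma fv_fn_val:
  assumes "counters c \<subseteq> {0, 1}"
  shows "fv_val (fn_val c \<tau>) \<subseteq> (\<Union>j\<in>labels c. fv_val (\<tau> j))"
  using assms by (cases c) (auto simp: fn_val_def call_val_def app2_def var_defs)

text \<open>All names bound by the code around the values \<open>\<tau> j\<close> are below 7 and no
  \<open>fvar j\<close> is, so values whose free variables are function variables are not captured.
  Closedness is not assumed, because the expansion of \<open>mrec\<close> substitutes open
  values.\<close>

lemma subst_fn_val:
  assumes \<sigma>: "\<And>x. x \<notin> range fvar \<Longrightarrow> \<sigma> x = Var x" "\<And>j. fv_val (\<sigma> (fvar j)) \<subseteq> range fvar"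
    and c: "counters c \<subseteq> {0, 1}"
  shows "subst_val \<sigma> (fn_val c \<tau>) = fn_val c (\<lambda>j. subst_val \<sigma> (\<tau> j))"
proof -
  have not_f: "b \<notin> range fvar" if "b < 7" for b using that by (auto simp: fvar_def)
  have [simp]: "fresh_binder \<sigma> b A = b" if "b < 7" for b A
  proof (rule fresh_binder_id)
    fix y assume "y \<noteq> b"
    then show "b \<notin> fv_val (\<sigma> y)" using \<sigma> not_f[OF that] by (cases "y \<in> range fvar") auto
  qed
  have upd[simp]: "\<sigma>(b := Var b) = \<sigma>" if "b < 7" for b
    using \<sigma>(1)[OF not_f[OF that]] by auto
  have [simp]: "\<sigma> b = Var b" if "b < 7" for b
    using \<sigma>(1)[OF not_f[OF that]] .
  show ?thesis
    using c by (cases c) (auto simp: fn_val_def call_val_def app2_def var_defs Let_def)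
qed

text \<open>
  \<open>Rep I R j v\<close>: the value \<open>v\<close> represents the function \<open>f\<^sub>j\<close> of the program with instructions
  \<open>I\<close>, where the functions \<open>f\<^sub>r\<close> with \<open>r \<in> R\<close> may occur free. Unfolding \<open>rec\<close> substitutes different
  values for different occurrences of the same \<open>f\<^sub>j\<close>, but all of them satisfy this relation.
\<close>

inductive Rep :: "(nat \<Rightarrow> instr) \<Rightarrow> nat set \<Rightarrow> nat \<Rightarrow> val \<Rightarrow> bool" for I where
  Rep_Var: "j \<in> R \<Longrightarrow> Rep I R j (Var (fvar j))"
| Rep_Rec: "(\<And>j. j \<in> labels (I i) \<Longrightarrow> Rep I (insert i R) j (\<tau> j)) \<Longrightarrow>
    Rep I R i (Rec (fvar i) (fn_val (I i) \<tau>))"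

lemma Rep_mono: "Rep I R j v \<Longrightarrow> R \<subseteq> R' \<Longrightarrow> Rep I R' j v"
proof (induction arbitrary: R' rule: Rep.induct)
  case (Rep_Var j R)
  then show ?case by (auto intro: Rep.Rep_Var)
next
  case (Rep_Rec i R \<tau>)
  show ?case by (rule Rep.Rep_Rec) (use Rep_Rec in blast)
qed

lemma fvar_inject: "fvar i = fvar j \<longleftrightarrow> i = j"
  by (simp add: fvar_def)

lemma fv_Rep:
  assumes "Rep I R j v" "\<And>i. counters (I i) \<subseteq> {0, 1}"
  shows "fv_val v \<subseteq> fvar ` R"
  using assms(1)
proof (induction rule: Rep.induct)
  case (Rep_Rec i R \<tau>)
  have "fv_val (fn_val (I i) \<tau>) \<subseteq> fvar ` insert i R"
    using fv_fn_val[OF assms(2)[of i], of \<tau>] Rep_Rec by blast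
  then show ?case by auto
qed auto

text \<open>Under \<open>Rec (fvar i)\<close> the substitution is reset at \<open>fvar i\<close>,
  and exactly this index joins the admissible free ones. Everything that \<open>\<sigma>\<close>
  really replaces becomes closed, so binders keep their names.\<close>

lemma Rep_subst:
  assumes "Rep I R j v" "\<And>i. counters (I i) \<subseteq> {0, 1}"
    and "\<And>x. x \<notin> range fvar \<Longrightarrow> \<sigma> x = Var x"
    and "\<And>r. \<sigma> (fvar r) = Var (fvar r) \<or> Rep I {} r (\<sigma> (fvar r))"
    and "\<And>r. r \<in> R \<Longrightarrow> \<sigma> (fvar r) = Var (fvar r) \<Longrightarrow> r \<in> R'"
  shows "Rep I R' j (subst_val \<sigma> v)"
  using assms(1,3-)
proof (induction arbitrary: \<sigma> R' rule: Rep.induct)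
  case (Rep_Var j R)
  show ?case
  proof (cases "\<sigma> (fvar j) = Var (fvar j)")
    case True
    then show ?thesis using Rep_Var by (auto intro: Rep.Rep_Var)
  next
    case False
    then have "Rep I {} j (\<sigma> (fvar j))" using Rep_Var.prems(2) by blast
    from Rep_mono[OF this] show ?thesis by simp
  qed
next
  case (Rep_Rec i R \<tau>)
  let ?\<sigma> = "\<sigma>(fvar i := Var (fvar i))"
  have clos: "\<sigma> (fvar r) = Var (fvar r) \<or> fv_val (\<sigma> (fvar r)) = {}" for r
    using Rep_Rec.prems(2)[of r] fv_Rep[OF _ assms(2)] by fastforce
  have "closing \<sigma>"
    unfolding closing_def using clos Rep_Rec.prems(1) by (metis rangeE)
  then have fr: "fresh_binder \<sigma> (fvar i) A = fvar i" for A by (rule fresh_binder_closing)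
  have "subst_val ?\<sigma> (fn_val (I i) \<tau>) = fn_val (I i) (\<lambda>j. subst_val ?\<sigma> (\<tau> j))"
  proof (rule subst_fn_val)
    fix j show "fv_val (?\<sigma> (fvar j)) \<subseteq> range fvar"
      using clos[of j] by auto
  qed (use Rep_Rec.prems(1) assms(2) in auto)
  moreover have "Rep I (insert i R') j (subst_val ?\<sigma> (\<tau> j))" if "j \<in> labels (I i)" for j
    by (rule Rep_Rec.IH[OF that])
      (use Rep_Rec.prems in \<open>auto simp: fvar_inject split: if_splits\<close>)
  ultimately show ?case by (simp add: fr Let_def Rep.Rep_Rec)
qed

section \<open>Deterministic reduction\<close>

inductive_cases step_ReturnE: "Return v \<rightarrow>c c"
inductive_cases step_OpE: "Op opn v \<rightarrow>c c"
inductive_cases step_AppE: "App u v \<rightarrow>c c"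
inductive_cases step_LetInE: "LetIn x c d \<rightarrow>c c'"
inductive_cases step_HandleE: "Handle h c \<rightarrow>c c'"

text \<open>A handler may have several clauses for one operation, and the name bound in a
  continuation is arbitrary, so reducts are not unique in general. Uniqueness is therefore
  established step by step.\<close>

definition det :: "comp \<Rightarrow> comp \<Rightarrow> bool" where
  "det c c' \<longleftrightarrow> c \<rightarrow>c c' \<and> (\<forall>c''. c \<rightarrow>c c'' \<longrightarrow> c'' = c')"

lemma det_step: "det c c' \<Longrightarrow> c \<rightarrow>c c'"
  by (simp add: det_def)

lemma det_LetIn: "det c c' \<Longrightarrow> det (LetIn x c d) (LetIn x c' d)"
  unfolding det_def by (auto intro: step.step_let elim!: step_LetInE elim: step_ReturnE)

lemma det_LetIn_Return: "det (LetIn x (Return v) d) (subst_comp (Var(x := v)) d)"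
  unfolding det_def by (auto intro: step.step_let_return elim!: step_LetInE elim: step_ReturnE)

lemma det_beta: "det (App (Lam x c) v) (subst_comp (Var(x := v)) c)"
  unfolding det_def by (auto intro: step.step_beta elim!: step_AppE)

lemma det_Rec: "det (App (Rec x u) v) (App (subst_val (Var(x := Rec x u)) u) v)"
  unfolding det_def by (auto intro: step.step_rec elim!: step_AppE)

text \<open>A pending operation is stuck inside evaluation contexts, so reducing under a handler and
  handling an operation exclude each other.\<close>

lemma no_step_plug_Op: "\<not> plug E (Op opn v) \<rightarrow>c c"
proof (induction E arbitrary: c)
  case Hole
  then show ?case by (auto elim: step_OpE)
next
  case (ELet x E d)
  have "plug E (Op opn v) \<noteq> Return w" for w by (cases E) auto
  moreover have "Return w \<noteq> plug E (Op opn v)" for w using calculation[of w] by simp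
  ultimately show ?case using ELet by (auto elim!: step_LetInE)
qed

lemma det_Handle:
  assumes "det c c'"
  shows "det (Handle h c) (Handle h c')"
proof -
  have "d = Handle h c'" if "Handle h c \<rightarrow>c d" for d
    using that assms by cases (auto simp: det_def no_step_plug_Op elim: step_ReturnE)
  with assms show ?thesis by (auto simp: det_def intro: step.step_handle)
qed

lemma det_Handle_Return:
  assumes "return_clause h = (x, c)"
  shows "det (Handle h (Return v)) (subst_comp (Var(x := v)) c)"
proof -
  have "Return v \<noteq> plug E (Op opn u)" for E opn u by (cases E) auto
  then have "d = subst_comp (Var(x := v)) c" if "Handle h (Return v) \<rightarrow>c d" for d
    using that assms by (auto elim!: step_HandleE elim: step_ReturnE)
  with assms show ?thesis by (auto simp: det_def intro: step.step_handle_return)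
qed

text \<open>
  A clause that ignores its continuation reduces deterministically although the name of the
  variable bound in the continuation is arbitrary.
\<close>

lemma det_Handle_Op:
  assumes "\<And>u. fv_val u = {} \<Longrightarrow> subst_comp (Var(x := v, k := u)) c = d"
    and "fv_handler (HOp opn x k c (HReturn z e)) = {}"
  shows "det (Handle (HOp opn x k c (HReturn z e)) (Op opn v)) d"
proof -
  let ?h = "HOp opn x k c (HReturn z e)"
  have plug: "E = Hole \<and> opn' = opn \<and> v' = v" if "Op opn v = plug E (Op opn' v')" for E opn' v'
    using that by (cases E) auto
  have clos: "fv_val (Lam y (Handle ?h (Return (Var y)))) = {}" for y using assms(2) by auto
  obtain y where y: "y \<notin> fv_comp (Handle ?h (plug Hole (Op opn v)))"
    using ex_new_if_finite[OF infinite_UNIV_nat finite_fv(2)] by metis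
  have "Handle ?h (plug Hole (Op opn v)) \<rightarrow>c
      subst_comp (Var(x := v, k := Lam y (Handle ?h (plug Hole (Return (Var y)))))) c"
    by (rule step.step_handle_op[OF _ y]) simp
  then have "Handle ?h (Op opn v) \<rightarrow>c d" by (simp only: plug.simps assms(1)[OF clos])
  moreover have "d' = d" if "Handle ?h (Op opn v) \<rightarrow>c d'" for d'
    using that
  proof cases
    case (step_handle c')
    from step_handle(2) show ?thesis by (rule step_OpE)
  next
    case (step_handle_op opn' x' k' c' y' E v')
    have E: "E = Hole" "v' = v" "opn' = opn" using plug[OF step_handle_op(1)] by simp_all
    moreover have "x' = x" "k' = k" "c' = c" using step_handle_op(3) by simp_all
    ultimately have "d' = subst_comp (Var(x := v, k := Lam y' (Handle ?h (Return (Var y'))))) c"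
      using step_handle_op(2) by (simp only: plug.simps)
    also have "\<dots> = d" by (rule assms(1)[OF clos])
    finally show ?thesis .
  qed
  ultimately show ?thesis unfolding det_def by blast
qed

lemma det_LetIn_rtranclp: "det\<^sup>*\<^sup>* c c' \<Longrightarrow> det\<^sup>*\<^sup>* (LetIn x c d) (LetIn x c' d)"
proof (induction rule: rtranclp_induct)
  case (step c' c'')
  show ?case by (rule rtranclp.rtrancl_into_rtrancl[OF step.IH det_LetIn[OF step.hyps(2)]])
qed simp

lemma det_steps: "det\<^sup>*\<^sup>* c c' \<Longrightarrow> c \<rightarrow>c* c'"
proof (induction rule: rtranclp_induct)
  case (step c' c'')
  show ?case by (rule rtranclp.rtrancl_into_rtrancl[OF step.IH det_step[OF step.hyps(2)]])
qed simp

text \<open>A value has no reduct, so a reduction to it must pass through the forced steps. The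
  strict decrease in length supports the induction in the simulation.\<close>

lemma det_relpowp:
  assumes "det\<^sup>+\<^sup>+ c c'" "(step ^^ n) c (Return v)"
  shows "\<exists>m<n. (step ^^ m) c' (Return v)"
  using assms
proof (induction arbitrary: n rule: converse_tranclp_induct)
  case (base c)
  show ?case
  proof (cases n)
    case 0
    with base show ?thesis by (auto simp: det_def elim: step_ReturnE)
  next
    case (Suc m)
    with base obtain d where "c \<rightarrow>c d" "(step ^^ m) d (Return v)" by (metis relpowp_Suc_D2)
    with base(1) Suc show ?thesis by (auto simp: det_def)
  qed
next
  case (step c d)
  then have "\<exists>m<n. (step ^^ m) d (Return v)"
  proof (cases n)
    case 0
    with step show ?thesis by (auto simp: det_def elim: step_ReturnE)
  next
    case (Suc m)
    with step.prems obtain d' where "c \<rightarrow>c d'" "(step ^^ m) d' (Return v)" by (metis relpowp_Suc_D2)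
    with step.hyps(1) Suc show ?thesis by (auto simp: det_def)
  qed
  with step.IH show ?case by (meson less_trans)
qed

lemma det_Return_iff:
  assumes "det\<^sup>*\<^sup>* c c'"
  shows "c \<rightarrow>c* Return v \<longleftrightarrow> c' \<rightarrow>c* Return v"
proof
  assume "c \<rightarrow>c* Return v"
  then obtain n where n: "(step ^^ n) c (Return v)" using rtranclp_power by metis
  show "c' \<rightarrow>c* Return v"
  proof (cases "c = c'")
    case False
    with assms have "det\<^sup>+\<^sup>+ c c'" by (auto dest: rtranclpD)
    from det_relpowp[OF this n] show ?thesis using rtranclp_power by metis
  qed (use \<open>c \<rightarrow>c* Return v\<close> in simp)
next
  assume "c' \<rightarrow>c* Return v"
  then show "c \<rightarrow>c* Return v" using det_steps[OF assms] by (rule rtranclp_trans[rotated])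
qed

section \<open>Simulation of two-counter machines\<close>

text \<open>Applied to \<open>Unit\<close>, \<open>num (Suc n)\<close> performs the operation with
  its predecessor as argument, which the clause of \<open>c_dec\<close> binds to the counter
  variable; \<open>num 0\<close> returns and thereby selects the branch for zero.\<close>

primrec num :: "nat \<Rightarrow> val" where
  "num 0 = Lam vx (Return Unit)"
| "num (Suc n) = Lam vy (Op succ_op (num n))"

lemma fv_num: "fv_val (num n) = {}"
  by (induction n) auto

definition Conf :: "(nat \<Rightarrow> instr) \<Rightarrow> nat \<times> nat \<times> nat \<Rightarrow> comp \<Rightarrow> bool" where
  "Conf I cf c \<longleftrightarrow> (case cf of (p, x, y) \<Rightarrow>
     \<exists>u. Rep I {} p u \<and> c = LetIn vz (app2 u (num x) (num y)) (Return TT))"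

lemmas closing_simps = closing_Var closing_upd closing_upd_Var fresh_binder_closing fv_num

lemma closed_Rep:
  assumes "Rep I {} j v" "\<And>i. counters (I i) \<subseteq> {0, 1}"
  shows "fv_val v = {}"
  using fv_Rep[OF assms] by simp

text \<open>The reductions are the unfolding of \<open>rec\<close>, two beta steps and the
  \<open>let\<close> between these. The substituted value \<open>u\<close> itself represents the
  function, so the values at the labels are closed representatives again.\<close>

lemma det_call:
  assumes I: "\<And>i. counters (I i) \<subseteq> {0, 1}" and u: "Rep I {} p u"
  shows "\<exists>\<tau>. (\<forall>j\<in>labels (I p). Rep I {} j (\<tau> j)) \<and>
    det\<^sup>+\<^sup>+ (LetIn vz (app2 u (num x) (num y)) d)
      (LetIn vz (subst_comp (Var(xvar 1 := num y)) (subst_comp (Var(xvar 0 := num x))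
        (inst_comp (I p) \<tau>))) d)"
  using u
proof cases
  case (Rep_Rec \<tau>)
  let ?\<sigma> = "Var(fvar p := u)"
  define \<tau>' where "\<tau>' = (\<lambda>j. subst_val ?\<sigma> (\<tau> j))"
  have cu: "fv_val u = {}" by (rule closed_Rep[OF u I])
  have rep: "Rep I {} j (\<tau>' j)" if "j \<in> labels (I p)" for j
    unfolding \<tau>'_def
    by (rule Rep_subst[OF Rep_Rec(2)[OF that] I])
      (use u Rep_Rec in \<open>auto simp: fvar_inject\<close>)
  have fn: "subst_val ?\<sigma> (fn_val (I p) \<tau>) = fn_val (I p) \<tau>'"
    unfolding \<tau>'_def by (rule subst_fn_val) (use cu I in auto)
  let ?b = "subst_comp (Var(xvar 0 := num x)) (inst_comp (I p) \<tau>')"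
  have 1: "det (app2 u (num x) (num y))
      (LetIn vw (App (fn_val (I p) \<tau>') (num x)) (App (Var vw) (num y)))"
    using det_LetIn[OF det_Rec[of "fvar p" "fn_val (I p) \<tau>" "num x"]] Rep_Rec(1) fn
    by (simp add: app2_def)
  have "(Var(xvar 0 := num x))(xvar 1 := Var (xvar 1)) = Var(xvar 0 := num x)"
    by (auto simp: xvar_def)
  then have "det (App (fn_val (I p) \<tau>') (num x)) (Return (Lam (xvar 1) ?b))"
    using det_beta[of "xvar 0" "Return (Lam (xvar 1) (inst_comp (I p) \<tau>'))" "num x"]
    by (simp add: fn_val_def Let_def closing_simps)
  then have 2: "det (LetIn vw (App (fn_val (I p) \<tau>') (num x)) (App (Var vw) (num y)))
     (LetIn vw (Return (Lam (xvar 1) ?b)) (App (Var vw) (num y)))" by (rule det_LetIn)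
  have 3: "det (LetIn vw (Return (Lam (xvar 1) ?b)) (App (Var vw) (num y)))
      (App (Lam (xvar 1) ?b) (num y))"
    using det_LetIn_Return[of vw "Lam (xvar 1) ?b" "App (Var vw) (num y)"]
    by (simp add: subst_closed fv_num)
  have 4: "det (App (Lam (xvar 1) ?b) (num y)) (subst_comp (Var(xvar 1 := num y)) ?b)"
    by (rule det_beta)
  note chain = 1 2 3 4
  have "det\<^sup>+\<^sup>+ (LetIn vz (app2 u (num x) (num y)) d)
      (LetIn vz (subst_comp (Var(xvar 1 := num y)) ?b) d)"
    by (rule tranclp.trancl_into_trancl[OF tranclp.trancl_into_trancl[OF
          tranclp.trancl_into_trancl[OF tranclp.r_into_trancl]]])
      (rule det_LetIn chain)+
  with rep show ?thesis by blast
qed simp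

lemma det_Dec:
  assumes "fv_handler (HOp succ_op x vk c (HReturn vx e)) = {}"
    and "\<And>u. fv_val u = {} \<Longrightarrow> subst_comp (Var(x := num n, vk := u)) c = c'"
  shows "det\<^sup>*\<^sup>* (Handle (HOp succ_op x vk c (HReturn vx e)) (App (num (Suc n)) Unit)) c'"
proof -
  let ?h = "HOp succ_op x vk c (HReturn vx e)"
  have "det (App (num (Suc n)) Unit) (Op succ_op (num n))"
    using det_beta[of vy "Op succ_op (num n)" Unit] by (simp add: subst_closed fv_num)
  then have "det (Handle ?h (App (num (Suc n)) Unit)) (Handle ?h (Op succ_op (num n)))"
    by (rule det_Handle)
  moreover have "det (Handle ?h (Op succ_op (num n))) c'"
    by (rule det_Handle_Op) (use assms in auto)
  ultimately show ?thesis by (meson converse_rtranclp_into_rtranclp rtranclp.rtrancl_refl)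
qed

lemma det_Dec_0:
  assumes "fv_comp e = {}"
  shows "det\<^sup>*\<^sup>* (Handle (HOp succ_op x vk c (HReturn vx e)) (App (num 0) Unit)) e"
proof -
  let ?h = "HOp succ_op x vk c (HReturn vx e)"
  have "det (App (num 0) Unit) (Return Unit)"
    using det_beta[of vx "Return Unit" Unit] by simp
  then have "det (Handle ?h (App (num 0) Unit)) (Handle ?h (Return Unit))" by (rule det_Handle)
  moreover have "det (Handle ?h (Return Unit)) e"
    using det_Handle_Return[of ?h vx e Unit] subst_id(2)[of e "Var(vx := Unit)"] assms by simp
  ultimately show ?thesis by (meson converse_rtranclp_into_rtranclp rtranclp.rtrancl_refl)
qed

lemma Conf_mnext:
  assumes I: "\<And>i. counters (I i) \<subseteq> {0, 1}" and C: "Conf I (p, x, y) c" and p: "I p \<noteq> CHalt"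
  shows "\<exists>c'. det\<^sup>+\<^sup>+ c c' \<and> Conf I (mnext I (p, x, y)) c'"
proof -
  from C obtain u where u: "Rep I {} p u" "c = LetIn vz (app2 u (num x) (num y)) (Return TT)"
    by (auto simp: Conf_def)
  from det_call[OF I u(1), of x y "Return TT"] obtain \<tau> where
    \<tau>: "\<And>j. j \<in> labels (I p) \<Longrightarrow> Rep I {} j (\<tau> j)" and
    run: "det\<^sup>+\<^sup>+ c (LetIn vz (subst_comp (Var(xvar 1 := num y)) (subst_comp (Var(xvar 0 := num x))
        (inst_comp (I p) \<tau>))) (Return TT))"
    using u(2) by blast
  have cl: "fv_val (\<tau> j) = {}" if "j \<in> labels (I p)" for j
    by (rule closed_Rep[OF \<tau>[OF that] I])
  \<comment> \<open>Only the computation under the outer \<open>let\<close> moves. The value called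
    in the end is some \<open>\<tau> j\<close>, which represents the target function by the choice
    of \<open>\<tau>\<close>.\<close>
  have "\<exists>j x' y'. j \<in> labels (I p) \<and> mnext I (p, x, y) = (j, x', y') \<and>
    det\<^sup>*\<^sup>* (subst_comp (Var(xvar 1 := num y)) (subst_comp (Var(xvar 0 := num x))
        (inst_comp (I p) \<tau>))) (app2 (\<tau> j) (num x') (num y'))"
  proof (cases "I p")
    case CHalt
    with p show ?thesis by simp
  next
    case (CInc i j)
    have clj: "fv_val (\<tau> j) = {}" using cl CInc by simp
    consider "i = 0" | "i = 1" using I[of p] CInc by auto
    then show ?thesis
    proof cases
      case 1
      have "subst_comp (Var(xvar 1 := num y)) (subst_comp (Var(xvar 0 := num x)) (inst_comp (I p) \<tau>))
        = LetIn (xvar 0) (Return (num (Suc x))) (app2 (\<tau> j) (Var (xvar 0)) (num y))"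
        using 1 by (simp add: CInc call_val_def app2_def Let_def closing_simps subst_closed clj;
            simp add: var_defs)
      moreover have "det \<dots> (app2 (\<tau> j) (num (Suc x)) (num y))"
        using det_LetIn_Return[of "xvar 0" "num (Suc x)" "app2 (\<tau> j) (Var (xvar 0)) (num y)"]
        by (simp add: app2_def Let_def closing_simps subst_closed clj; simp add: var_defs)
      ultimately show ?thesis using 1 CInc by auto
    next
      case 2
      have "subst_comp (Var(xvar 1 := num y)) (subst_comp (Var(xvar 0 := num x)) (inst_comp (I p) \<tau>))
        = LetIn (xvar 1) (Return (num (Suc y))) (app2 (\<tau> j) (num x) (Var (xvar 1)))"
        using 2 by (simp add: CInc call_val_def app2_def Let_def closing_simps subst_closed clj;
            simp add: var_defs)
      moreover have "det \<dots> (app2 (\<tau> j) (num x) (num (Suc y)))"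
        using det_LetIn_Return[of "xvar 1" "num (Suc y)" "app2 (\<tau> j) (num x) (Var (xvar 1))"]
        by (simp add: app2_def Let_def closing_simps subst_closed clj; simp add: var_defs)
      ultimately show ?thesis using 2 CInc by auto
    qed
  next
    case (CDec i j m)
    have clj: "fv_val (\<tau> j) = {}" "fv_val (\<tau> m) = {}" using cl CDec by simp_all
    consider "i = 0" | "i = 1" using I[of p] CDec by auto
    then show ?thesis
    proof cases
      case 1
      have eq: "subst_comp (Var(xvar 1 := num y)) (subst_comp (Var(xvar 0 := num x)) (inst_comp (I p) \<tau>))
        = Handle (HOp succ_op (xvar 0) vk (app2 (\<tau> m) (Var (xvar 0)) (num y))
            (HReturn vx (app2 (\<tau> j) (num x) (num y)))) (App (num x) Unit)"
        using 1 by (simp add: CDec call_val_def app2_def Let_def closing_simps subst_closed clj;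
            simp add: var_defs)
      show ?thesis
      proof (cases x)
        case 0
        have "det\<^sup>*\<^sup>* (Handle (HOp succ_op (xvar 0) vk (app2 (\<tau> m) (Var (xvar 0)) (num y))
            (HReturn vx (app2 (\<tau> j) (num x) (num y)))) (App (num x) Unit)) (app2 (\<tau> j) (num x) (num y))"
          unfolding 0 by (rule det_Dec_0) (simp add: app2_def clj fv_num)
        then show ?thesis unfolding eq using 0 1 CDec by auto
      next
        case (Suc x')
        have "det\<^sup>*\<^sup>* (Handle (HOp succ_op (xvar 0) vk (app2 (\<tau> m) (Var (xvar 0)) (num y))
            (HReturn vx (app2 (\<tau> j) (num x) (num y)))) (App (num x) Unit)) (app2 (\<tau> m) (num x') (num y))"
          unfolding Suc
          by (rule det_Dec)
            (auto simp: app2_def clj closing_simps subst_closed Let_def var_defs simp del: num.simps)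
        then show ?thesis unfolding eq using Suc 1 CDec by auto
      qed
    next
      case 2
      have eq: "subst_comp (Var(xvar 1 := num y)) (subst_comp (Var(xvar 0 := num x)) (inst_comp (I p) \<tau>))
        = Handle (HOp succ_op (xvar 1) vk (app2 (\<tau> m) (num x) (Var (xvar 1)))
            (HReturn vx (app2 (\<tau> j) (num x) (num y)))) (App (num y) Unit)"
        using 2 by (simp add: CDec call_val_def app2_def Let_def closing_simps subst_closed clj;
            simp add: var_defs)
      show ?thesis
      proof (cases y)
        case 0
        have "det\<^sup>*\<^sup>* (Handle (HOp succ_op (xvar 1) vk (app2 (\<tau> m) (num x) (Var (xvar 1)))
            (HReturn vx (app2 (\<tau> j) (num x) (num y)))) (App (num y) Unit)) (app2 (\<tau> j) (num x) (num y))"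
          unfolding 0 by (rule det_Dec_0) (simp add: app2_def clj fv_num)
        then show ?thesis unfolding eq using 0 2 CDec by auto
      next
        case (Suc y')
        have "det\<^sup>*\<^sup>* (Handle (HOp succ_op (xvar 1) vk (app2 (\<tau> m) (num x) (Var (xvar 1)))
            (HReturn vx (app2 (\<tau> j) (num x) (num y)))) (App (num y) Unit)) (app2 (\<tau> m) (num x) (num y'))"
          unfolding Suc
          by (rule det_Dec)
            (auto simp: app2_def clj closing_simps subst_closed Let_def var_defs simp del: num.simps)
        then show ?thesis unfolding eq using Suc 2 CDec by auto
      qed
    qed
  qed
  then obtain j x' y' where j: "j \<in> labels (I p)" "mnext I (p, x, y) = (j, x', y')" and
    d: "det\<^sup>*\<^sup>* (subst_comp (Var(xvar 1 := num y)) (subst_comp (Var(xvar 0 := num x))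
        (inst_comp (I p) \<tau>))) (app2 (\<tau> j) (num x') (num y'))" by blast
  have "det\<^sup>+\<^sup>+ c (LetIn vz (app2 (\<tau> j) (num x') (num y')) (Return TT))"
    by (rule tranclp_rtranclp_tranclp[OF run det_LetIn_rtranclp[OF d]])
  then show ?thesis using j \<tau>[OF j(1)] by (auto simp: Conf_def)
qed

lemma Conf_CHalt:
  assumes I: "\<And>i. counters (I i) \<subseteq> {0, 1}" and C: "Conf I (p, x, y) c" and p: "I p = CHalt"
  shows "c \<rightarrow>c* Return TT"
proof -
  from C obtain u where u: "Rep I {} p u" "c = LetIn vz (app2 u (num x) (num y)) (Return TT)"
    by (auto simp: Conf_def)
  from det_call[OF I u(1), of x y "Return TT"] p u(2)
  have "det\<^sup>+\<^sup>+ c (LetIn vz (Return Unit) (Return TT))" by auto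
  then have "c \<rightarrow>c* LetIn vz (Return Unit) (Return TT)" by (rule det_steps[OF tranclp_into_rtranclp])
  moreover have "LetIn vz (Return Unit) (Return TT) \<rightarrow>c Return TT"
    using det_LetIn_Return[of vz Unit "Return TT"] by (auto dest: det_step)
  ultimately show ?thesis by (rule rtranclp.rtrancl_into_rtrancl)
qed

text \<open>Each machine step costs at least one forced reduction, so what remains of a reduction to
  \<open>Return TT\<close> shrinks with every machine step, and the run must meet
  \<open>CHalt\<close>.\<close>

lemma Conf_halts:
  assumes I: "\<And>i. counters (I i) \<subseteq> {0, 1}" and C: "Conf I cf c"
  shows "c \<rightarrow>c* Return TT \<longleftrightarrow> halts I cf"
proof
  assume "c \<rightarrow>c* Return TT"
  then obtain n where "(step ^^ n) c (Return TT)" using rtranclp_power by metis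
  then show "halts I cf" using C
  proof (induction n arbitrary: c cf rule: less_induct)
    case (less n)
    obtain p x y where cf: "cf = (p, x, y)" by (cases cf)
    show ?case
    proof (cases "I p = CHalt")
      case True
      then show ?thesis using cf halts_CHalt by simp
    next
      case False
      from Conf_mnext[OF I less.prems(2)[unfolded cf] False] obtain c' where
        c': "det\<^sup>+\<^sup>+ c c'" "Conf I (mnext I cf) c'" using cf by blast
      from det_relpowp[OF c'(1) less.prems(1)] less.IH c'(2) have "halts I (mnext I cf)" by blast
      then show ?thesis by (simp only: halts_mnext)
    qed
  qed
next
  assume "halts I cf"
  then obtain t where "I (fst ((mnext I ^^ t) cf)) = CHalt" by (auto simp: halts_def)
  then show "c \<rightarrow>c* Return TT" using C
  proof (induction t arbitrary: c cf)
    case 0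
    obtain p x y where cf: "cf = (p, x, y)" by (cases cf)
    show ?case by (rule Conf_CHalt[OF I 0(2)[unfolded cf]]) (use 0(1) cf in simp)
  next
    case (Suc t)
    obtain p x y where cf: "cf = (p, x, y)" by (cases cf)
    show ?case
    proof (cases "I p = CHalt")
      case True
      show ?thesis by (rule Conf_CHalt[OF I Suc.prems(2)[unfolded cf] True])
    next
      case False
      from Conf_mnext[OF I Suc.prems(2)[unfolded cf] False] obtain c' where
        c': "det\<^sup>+\<^sup>+ c c'" "Conf I (mnext I cf) c'" using cf by blast
      have "c' \<rightarrow>c* Return TT"
        by (rule Suc.IH[OF _ c'(2)]) (use Suc.prems(1) in \<open>simp only: funpow_Suc_right comp_apply\<close>)
      then show ?thesis
        using det_steps[OF tranclp_into_rtranclp[OF c'(1)]] by (rule rtranclp_trans[rotated])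
    qed
  qed
qed

section \<open>Mutual recursion in closed form\<close>

lemma set_encode_remove:
  assumes "finite A" "i \<in> A"
  shows "set_encode A - 2 ^ i = set_encode (A - {i})"
  using sum.remove[OF assms, of "\<lambda>i. (2::nat) ^ i"] by (simp add: set_encode_def)

text \<open>
  \<open>mrec_val I m i\<close> is the value of \<open>f\<^sub>i\<close> in the mutual recursion restricted to the indices
  in \<open>set_decode m\<close>. Sets are represented by bit masks because tables indexed by sets are
  computed numerically below.
\<close>

function mrec_val :: "(nat \<Rightarrow> instr) \<Rightarrow> nat \<Rightarrow> nat \<Rightarrow> val" where
  "mrec_val I m i =
     (if i \<in> set_decode m
      then Rec (fvar i) (fn_val (I i)
        (\<lambda>j. if j \<in> set_decode (m - 2 ^ i) then mrec_val I (m - 2 ^ i) j else Var (fvar j)))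
      else Unit)"
  by auto
termination
proof (relation "measure (\<lambda>(I, m, i). m)")
  fix I :: "nat \<Rightarrow> instr" and m i j :: nat
  assume "i \<in> set_decode m"
  then have "m \<noteq> 0" by (metis empty_iff set_decode_zero)
  then show "((I, m - 2 ^ i, j), I, m, i) \<in> measure (\<lambda>(I, m, i). m)" by simp
qed simp

declare mrec_val.simps [simp del]

lemma mrec_val_set_encode:
  assumes "finite A" "i \<in> A"
  shows "mrec_val I (set_encode A) i = Rec (fvar i) (fn_val (I i)
    (\<lambda>j. if j \<in> A - {i} then mrec_val I (set_encode (A - {i})) j else Var (fvar j)))"
proof -
  have "set_encode A - 2 ^ i = set_encode (A - {i})" using assms by (rule set_encode_remove)
  moreover have "set_decode (set_encode A) = A" "set_decode (set_encode (A - {i})) = A - {i}"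
    using assms(1) by simp_all
  ultimately show ?thesis
    unfolding mrec_val.simps[of I "set_encode A" i] using assms(2) by (simp only: if_True)
qed

lemma fv_mrec_val:
  assumes "\<And>i. counters (I i) \<subseteq> {0, 1}" "finite A" "i \<in> A"
  shows "fv_val (mrec_val I (set_encode A) i) \<subseteq> fvar ` (- A)"
  using assms(2,3)
proof (induction A arbitrary: i rule: finite_psubset_induct)
  case (psubset A)
  let ?\<tau> = "\<lambda>j. if j \<in> A - {i} then mrec_val I (set_encode (A - {i})) j else Var (fvar j)"
  have "fv_val (?\<tau> j) \<subseteq> fvar ` (- (A - {i}))" for j
    using psubset.IH[of "A - {i}" j] psubset.prems by auto
  then have "fv_val (fn_val (I i) ?\<tau>) \<subseteq> fvar ` (- (A - {i}))"
    using fv_fn_val[OF assms(1)[of i], of ?\<tau>] by blast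
  then show ?case
    by (auto simp: mrec_val_set_encode[OF psubset.hyps psubset.prems])
qed

definition defs :: "(nat \<Rightarrow> instr) \<Rightarrow> nat list \<Rightarrow> (var \<times> val) list" where
  "defs I L = map (\<lambda>i. (fvar i, fn_val (I i) (\<lambda>j. Var (fvar j)))) L"

text \<open>No function variable of the list is free in any \<open>u j\<close>, so substituting one
  after the other amounts to a simultaneous substitution.\<close>

lemma foldr_subst_fn_val:
  assumes "counters c \<subseteq> {0, 1}" "distinct L"
    and "\<And>j. j \<in> set L \<Longrightarrow> fv_val (u j) \<subseteq> fvar ` (- set L)"
  shows "foldr (\<lambda>(f, w) v. subst_val (Var(f := w)) v) (map (\<lambda>j. (fvar j, u j)) L)
      (fn_val c (\<lambda>j. Var (fvar j))) =
    fn_val c (\<lambda>j. if j \<in> set L then u j else Var (fvar j))"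
  using assms(2,3)
proof (induction L)
  case (Cons a L)
  have "foldr (\<lambda>(f, w) v. subst_val (Var(f := w)) v) (map (\<lambda>j. (fvar j, u j)) L)
      (fn_val c (\<lambda>j. Var (fvar j))) =
    fn_val c (\<lambda>j. if j \<in> set L then u j else Var (fvar j))"
    by (rule Cons.IH) (use Cons.prems in fastforce)+
  moreover have "subst_val (Var(fvar a := u a)) (fn_val c \<tau>) =
      fn_val c (\<lambda>j. subst_val (Var(fvar a := u a)) (\<tau> j))" for \<tau>
  proof (rule subst_fn_val)
    fix j show "fv_val ((Var(fvar a := u a)) (fvar j)) \<subseteq> range fvar"
      using Cons.prems(2)[of a] by auto
  qed (use assms(1) in auto)
  moreover have "subst_val (Var(fvar a := u a)) (if j \<in> set L then u j else Var (fvar j)) =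
      (if j \<in> set (a # L) then u j else Var (fvar j))" for j
  proof (cases "j \<in> set L")
    case True
    then have "fvar a \<notin> fv_val (u j)" using Cons.prems(2)[of j] by (auto simp: fvar_inject)
    then have "subst_val (Var(fvar a := u a)) (u j) = u j" by (intro subst_id(1)) auto
    with True show ?thesis by simp
  qed (auto simp: fvar_inject)
  ultimately show ?case by (simp only: list.map foldr.simps comp_def case_prod_conv)
qed simp

text \<open>Dropping an entry of a distinct list removes exactly one index from its set, so the
  values depend on the set alone; this justifies the indexing by bit masks.\<close>

lemma mrec_binds_defs:
  assumes "\<And>i. counters (I i) \<subseteq> {0, 1}" "distinct L"
  shows "mrec_binds (defs I L) = map (\<lambda>i. (fvar i, mrec_val I (set_encode (set L)) i)) L"
  using assms(2)
proof (induction "length L" arbitrary: L rule: less_induct)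
  case less
  have len: "length (defs I L) = length L" by (simp add: defs_def)
  have "mrec_binds (defs I L) = map (\<lambda>k. (fvar (L ! k), mrec_val I (set_encode (set L)) (L ! k)))
      [0..<length L]"
    unfolding mrec_binds.simps[of "defs I L"] len
  proof (rule map_cong[OF refl])
    fix k assume "k \<in> set [0..<length L]"
    then have k: "k < length L" by simp
    let ?L = "take k L @ drop (Suc k) L"
    have rm: "take k (defs I L) @ drop (Suc k) (defs I L) = defs I ?L"
      by (simp add: defs_def take_map drop_map)
    have L: "L = take k L @ L ! k # drop (Suc k) L" using k by (rule id_take_nth_drop)
    have dist: "distinct ?L" "L ! k \<notin> set ?L"
    proof -
      have "distinct (take k L @ L ! k # drop (Suc k) L)" using less.prems L by metis
      then show "distinct ?L" "L ! k \<notin> set ?L" by auto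
    qed
    have set: "set ?L = set L - {L ! k}"
    proof -
      have "set L = set (take k L @ L ! k # drop (Suc k) L)" using L by metis
      then have "set L = insert (L ! k) (set ?L)" by auto
      with dist(2) show ?thesis by blast
    qed
    have "mrec_binds (defs I ?L) = map (\<lambda>i. (fvar i, mrec_val I (set_encode (set ?L)) i)) ?L"
      by (rule less.hyps) (use k dist in auto)
    moreover have "snd (defs I L ! k) = fn_val (I (L ! k)) (\<lambda>j. Var (fvar j))"
      using k by (simp add: defs_def)
    moreover have "foldr (\<lambda>(f, w) v. subst_val (Var(f := w)) v)
        (map (\<lambda>i. (fvar i, mrec_val I (set_encode (set ?L)) i)) ?L)
        (fn_val (I (L ! k)) (\<lambda>j. Var (fvar j))) = fn_val (I (L ! k))
        (\<lambda>j. if j \<in> set ?L then mrec_val I (set_encode (set ?L)) j else Var (fvar j))"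
      by (rule foldr_subst_fn_val[OF assms(1) dist(1) fv_mrec_val[OF assms(1) finite_set]])
    ultimately have "Rec (fvar (L ! k)) (foldr (\<lambda>(f, w) v. subst_val (Var(f := w)) v)
          (mrec_binds (defs I ?L)) (snd (defs I L ! k))) = mrec_val I (set_encode (set L)) (L ! k)"
      using mrec_val_set_encode[of "set L" "L ! k" I] k by (simp only: set finite_set nth_mem)
    moreover have "fst (defs I L ! k) = fvar (L ! k)" using k by (simp add: defs_def)
    ultimately show "(fst (defs I L ! k), Rec (fst (defs I L ! k))
        (foldr (\<lambda>(f, w) v. subst_val (Var(f := w)) v)
          (mrec_binds (take k (defs I L) @ drop (Suc k) (defs I L))) (snd (defs I L ! k)))) =
      (fvar (L ! k), mrec_val I (set_encode (set L)) (L ! k))"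
      by (simp only: rm)
  qed
  also have "\<dots> = map (\<lambda>i. (fvar i, mrec_val I (set_encode (set L)) i)) L"
    by (rule nth_equalityI) simp_all
  finally show ?case .
qed

text \<open>A label outside \<open>A - {i}\<close> is \<open>i\<close> itself, bound by the value's
  own \<open>rec\<close>, or lies outside \<open>A\<close> and may stay free. For
  \<open>A = {..n}\<close> no free function is left and the value is closed.\<close>

lemma Rep_mrec_val:
  assumes "\<And>i. i \<le> n \<Longrightarrow> wf_instr n (I i)" "A \<subseteq> {..n}" "i \<in> A"
  shows "Rep I ({..n} - A) i (mrec_val I (set_encode A) i)"
proof -
  have "finite A" using assms(2) finite_subset by blast
  then show ?thesis using assms(2,3)
  proof (induction A arbitrary: i rule: finite_psubset_induct)
    case (psubset A)
    have "Rep I (insert i ({..n} - A)) j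
        (if j \<in> A - {i} then mrec_val I (set_encode (A - {i})) j else Var (fvar j))"
      if "j \<in> labels (I i)" for j
    proof (cases "j \<in> A - {i}")
      case True
      have "{..n} - (A - {i}) = insert i ({..n} - A)" using psubset.prems by auto
      moreover have "Rep I ({..n} - (A - {i})) j (mrec_val I (set_encode (A - {i})) j)"
        by (rule psubset.IH) (use True psubset.prems in auto)
      ultimately show ?thesis using True by simp
    next
      case False
      have "i \<le> n" using psubset.prems by auto
      then have "j \<le> n" using assms(1) that by (auto simp: wf_instr_def)
      with False show ?thesis by (auto intro: Rep_Var)
    qed
    then show ?case
      unfolding mrec_val_set_encode[OF psubset.hyps psubset.prems(2)] by (rule Rep_Rec)
  qed
qed

section \<open>From machines to programs\<close>

definition machine_prog :: "nat \<Rightarrow> (nat \<Rightarrow> instr) \<Rightarrow> comp" where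
  "machine_prog n I = MM_prog n (\<lambda>i. inst_comp (I i) (\<lambda>j. Var (fvar j)))"

lemma machine_prog_MM: "(\<And>i. i \<le> n \<Longrightarrow> wf_instr n (I i)) \<Longrightarrow> machine_prog n I \<in> MM n"
  by (auto simp: machine_prog_def MM_def intro!: exI inst_comp_Inst)

definition main_body :: comp where
  "main_body = LetIn vz
     (app2 (Var (fvar 0)) (Lam vx (Return Unit)) (Lam vx (Return Unit))) (Return TT)"

lemma machine_prog_eq:
  assumes "\<And>i. counters (I i) \<subseteq> {0, 1}"
  shows "machine_prog n I = foldr (\<lambda>i. LetIn (fvar i) (Return (mrec_val I (set_encode {..n}) i)))
    [0..<Suc n] main_body"
proof -
  have "map (\<lambda>i. (fvar i, Lam (xvar 0) (Return (Lam (xvar 1) (inst_comp (I i) (\<lambda>j. Var (fvar j)))))))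
      [0..<Suc n] = defs I [0..<Suc n]" by (simp add: defs_def fn_val_def)
  moreover have "set [0..<Suc n] = {..n}" by auto
  ultimately show ?thesis
    unfolding machine_prog_def MM_prog_def mrec_def main_body_def
    by (simp only: mrec_binds_defs[OF assms distinct_upt] foldr_map comp_def case_prod_conv)
qed

lemma det_closed_lets:
  assumes "\<And>i. i \<in> set L \<Longrightarrow> fv_val (u i) = {}" "fv_comp c = {}"
  shows "fv_comp (foldr (\<lambda>i. LetIn (fvar i) (Return (u i))) L c) = {} \<and>
    det\<^sup>*\<^sup>* (foldr (\<lambda>i. LetIn (fvar i) (Return (u i))) L c) c"
  using assms(1)
proof (induction L)
  case (Cons a L)
  let ?d = "foldr (\<lambda>i. LetIn (fvar i) (Return (u i))) L c"
  have IH: "fv_comp ?d = {}" "det\<^sup>*\<^sup>* ?d c" using Cons by auto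
  have "subst_comp (Var(fvar a := u a)) ?d = ?d" by (rule subst_id(2)) (simp add: IH)
  then have "det (LetIn (fvar a) (Return (u a)) ?d) ?d" using det_LetIn_Return by metis
  then have "det\<^sup>*\<^sup>* (LetIn (fvar a) (Return (u a)) ?d) c"
    using IH(2) by (rule converse_rtranclp_into_rtranclp)
  then show ?case using IH(1) Cons.prems by simp
qed (simp add: assms(2))

lemma subst_lets:
  assumes "closing \<sigma>" "\<And>i. i \<in> set L \<Longrightarrow> fv_val (u i) = {}"
    and "\<And>i. i \<in> set L \<Longrightarrow> \<sigma> (fvar i) = Var (fvar i)"
  shows "subst_comp \<sigma> (foldr (\<lambda>i. LetIn (fvar i) (Return (u i))) L c) =
    foldr (\<lambda>i. LetIn (fvar i) (Return (u i))) L (subst_comp \<sigma> c)"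
  using assms(2,3)
proof (induction L)
  case (Cons a L)
  have "\<sigma>(fvar a := Var (fvar a)) = \<sigma>" using Cons.prems(2) by auto
  with Cons show ?case by (simp add: Let_def fresh_binder_closing[OF assms(1)] subst_closed)
qed simp

lemma machine_prog_halts:
  assumes "\<And>i. i \<le> n \<Longrightarrow> wf_instr n (I i)" and I: "\<And>i. counters (I i) \<subseteq> {0, 1}"
  shows "machine_prog n I \<rightarrow>c* Return TT \<longleftrightarrow> halts I (0, 0, 0)"
proof -
  let ?u = "mrec_val I (set_encode {..n})"
  let ?lets = "foldr (\<lambda>i. LetIn (fvar i) (Return (?u i)))"
  let ?c = "LetIn vz (app2 (?u 0) (num 0) (num 0)) (Return TT)"
  have rep: "Rep I {} i (?u i)" if "i \<le> n" for i
    using Rep_mrec_val[of n I "{..n}" i] assms(1) that by simp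
  have cl: "fv_val (?u i) = {}" if "i \<le> n" for i
    by (rule closed_Rep[OF rep[OF that] I])
  \<comment> \<open>The main body mentions only the function with index 0; its \<open>let\<close> is
    reduced separately, and the remaining closed bindings then disappear.\<close>
  have "[0..<Suc n] = 0 # [1..<Suc n]" by (simp add: upt_conv_Cons del: upt_Suc)
  then have "machine_prog n I = LetIn (fvar 0) (Return (?u 0)) (?lets [1..<Suc n] main_body)"
    by (simp only: machine_prog_eq[OF I] foldr.simps comp_def)
  then have "det (machine_prog n I) (subst_comp (Var(fvar 0 := ?u 0)) (?lets [1..<Suc n] main_body))"
    using det_LetIn_Return by simp
  also have "subst_comp (Var(fvar 0 := ?u 0)) (?lets [1..<Suc n] main_body) =
      ?lets [1..<Suc n] (subst_comp (Var(fvar 0 := ?u 0)) main_body)"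
    by (rule subst_lets)
      (use cl in \<open>auto simp: fvar_inject intro!: closing_upd closing_Var simp del: upt_Suc\<close>)
  also have "subst_comp (Var(fvar 0 := ?u 0)) main_body = ?c"
    by (simp add: main_body_def app2_def Let_def fresh_binder_closing closing_upd closing_upd_Var
        closing_Var cl; simp add: var_defs fvar_def)
  finally have "det (machine_prog n I) (?lets [1..<Suc n] ?c)" .
  moreover have "det\<^sup>*\<^sup>* (?lets [1..<Suc n] ?c) ?c"
    by (rule conjunct2[OF det_closed_lets]) (use cl in \<open>auto simp: app2_def simp del: upt_Suc\<close>)
  ultimately have "det\<^sup>*\<^sup>* (machine_prog n I) ?c" by (rule converse_rtranclp_into_rtranclp)
  then have "machine_prog n I \<rightarrow>c* Return TT \<longleftrightarrow> ?c \<rightarrow>c* Return TT" by (rule det_Return_iff)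
  moreover have "Conf I (0, 0, 0) ?c" using rep[of 0] by (auto simp: Conf_def)
  ultimately show ?thesis using Conf_halts[OF I] by simp
qed

section \<open>Computing the code of a program\<close>

text \<open>All instructions share one tuple shape, so the labels are decoded uniformly; an absent
  label decodes to 0, which is always a valid index.\<close>

definition instr_code :: "instr \<Rightarrow> nat" where
  "instr_code c = (case c of
     CHalt \<Rightarrow> prod_encode (0, prod_encode (0, prod_encode (0, 0)))
   | CInc i j \<Rightarrow> prod_encode (1, prod_encode (i, prod_encode (j, 0)))
   | CDec i j m \<Rightarrow> prod_encode (2, prod_encode (i, prod_encode (j, m))))"

definition label1 :: "nat \<Rightarrow> nat" where
  "label1 e = fst (prod_decode (snd (prod_decode (snd (prod_decode e)))))"

definition label2 :: "nat \<Rightarrow> nat" where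
  "label2 e = snd (prod_decode (snd (prod_decode (snd (prod_decode e)))))"

lemma label_le: "wf_instr n c \<Longrightarrow> label1 (instr_code c) \<le> n \<and> label2 (instr_code c) \<le> n"
  by (cases c) (auto simp: instr_code_def label1_def label2_def wf_instr_def)

definition call_code :: "nat \<Rightarrow> nat" where
  "call_code u = prod_encode (4, prod_encode (vw, prod_encode
     (prod_encode (2, prod_encode (u, code_val (Var (xvar 0)))), code_comp (App (Var vw) (Var (xvar 1))))))"

definition inst_comp_code :: "nat \<Rightarrow> nat \<Rightarrow> nat \<Rightarrow> nat \<Rightarrow> nat" where
  "inst_comp_code k i u w =
     (if k = 0 then code_comp (Return Unit)
      else if k = 1 then prod_encode (4, prod_encode (i, prod_encode
        (prod_encode (0, prod_encode (4, prod_encode (vy, prod_encode (1, prod_encode (succ_op,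
           prod_encode (0, i)))))), call_code u)))
      else prod_encode (5, prod_encode
        (prod_encode (1, prod_encode (succ_op, prod_encode (i, prod_encode (vk, prod_encode
           (call_code w, prod_encode (0, prod_encode (vx, call_code u))))))),
         prod_encode (2, prod_encode (prod_encode (0, i), code_val Unit)))))"

text \<open>
  \<open>rec_code e i u w\<close> is the code of \<open>rec f\<^sub>i = \<dots>\<close> for the instruction with code \<open>e\<close>, where \<open>u\<close>
  and \<open>w\<close> are the codes of the values to be called at its labels.
\<close>

definition rec_code :: "nat \<Rightarrow> nat \<Rightarrow> nat \<Rightarrow> nat \<Rightarrow> nat" where
  "rec_code e i u w = prod_encode (5, prod_encode (7 + i, prod_encode (4, prod_encode (xvar 0,
     prod_encode (0, prod_encode (4, prod_encode (xvar 1,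
       inst_comp_code (fst (prod_decode e)) (fst (prod_decode (snd (prod_decode e)))) u w)))))))"

lemma rec_code:
  "code_val (Rec (fvar i) (fn_val c \<tau>)) = rec_code (instr_code c) i
     (code_val (\<tau> (label1 (instr_code c)))) (code_val (\<tau> (label2 (instr_code c))))"
  by (cases c) (simp_all add: rec_code_def inst_comp_code_def call_code_def fn_val_def call_val_def
      app2_def instr_code_def label1_def label2_def fvar_def xvar_def)

text \<open>
  The number \<open>a\<close> presents the machine whose instructions with index at most \<open>fst (prod_decode a)\<close>
  are listed in \<open>snd (prod_decode a)\<close>, followed by \<open>prm 0 ^ a\<close> increments of the first counter
  that lead to instruction \<open>1\<close>. Thus instruction \<open>1\<close> can be entered with the Goedel number of a
  register content that provides the machine with its own presentation.
\<close>

definition last_index :: "nat \<Rightarrow> nat" where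
  "last_index a = fst (prod_decode a) + prm 0 ^ a"

definition fetch :: "nat \<Rightarrow> nat \<Rightarrow> nat" where
  "fetch a i = (if i \<le> fst (prod_decode a) then code_nth (snd (prod_decode a)) i
     else prod_encode (1, prod_encode (0, prod_encode (if i = last_index a then 1 else Suc i, 0))))"

definition lookup :: "nat \<Rightarrow> nat \<Rightarrow> nat \<Rightarrow> nat \<Rightarrow> nat \<Rightarrow> nat" where
  "lookup a t L m j = code_nth L (t - 1 - (m * Suc (last_index a) + j))"

definition target_code :: "nat \<Rightarrow> nat \<Rightarrow> nat \<Rightarrow> nat \<Rightarrow> nat \<Rightarrow> nat" where
  "target_code a t L m j =
     (if m div 2 ^ j mod 2 = 1 then lookup a t L m j else prod_encode (0, 7 + j))"

text \<open>
  The entry with number \<open>t = m * Suc (last_index a) + i\<close> of the table is the code of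
  \<open>mrec_val I m i\<close>. A table is a list code with the last entry first; \<open>L\<close> holds the first \<open>t\<close>
  entries.
\<close>

definition entry :: "nat \<Rightarrow> nat \<Rightarrow> nat \<Rightarrow> nat" where
  "entry t L a =
     (let m = t div Suc (last_index a); i = t mod Suc (last_index a); e = fetch a i in
      if m div 2 ^ i mod 2 = 1
      then rec_code e i (target_code a t L (m - 2 ^ i) (label1 e)) (target_code a t L (m - 2 ^ i) (label2 e))
      else code_val Unit)"

definition table :: "nat \<Rightarrow> nat \<Rightarrow> nat" where
  "table a t = rec_nat 0 (\<lambda>t L. prod_encode (entry t L a, L)) t"

definition table_length :: "nat \<Rightarrow> nat" where
  "table_length a = 2 ^ Suc (last_index a) * Suc (last_index a)"

text \<open>The chain of lets is built from the inside, hence step \<open>s\<close> treats index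
  \<open>last_index a - s\<close>. The mask with all bits set selects the unrestricted
  recursion.\<close>

definition let_code :: "nat \<Rightarrow> nat \<Rightarrow> nat \<Rightarrow> nat" where
  "let_code s acc a = prod_encode (4, prod_encode (7 + (last_index a - s), prod_encode
     (prod_encode (0, lookup a (table_length a) (table a (table_length a))
        (2 ^ Suc (last_index a) - 1) (last_index a - s)), acc)))"

definition prog_code :: "nat \<Rightarrow> nat" where
  "prog_code a = rec_nat (code_comp main_body) (\<lambda>s acc. let_code s acc a) (Suc (last_index a))"

text \<open>An entry is never altered; each later one only pushes it back by one place.\<close>

lemma code_nth_table: "t < T \<Longrightarrow> code_nth (table a T) (T - 1 - t) = entry t (table a t) a"
proof (induction T)
  case (Suc T)
  show ?case
  proof (cases "t = T")
    case True
    then show ?thesis by (simp add: table_def code_nth_def)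
  next
    case False
    then obtain d where d: "Suc T - 1 - t = Suc d" "d = T - 1 - t" using Suc.prems
      by (metis Suc_diff_Suc diff_Suc_1 diff_Suc_eq_diff_pred less_antisym)
    have "code_nth (prod_encode (x, L)) (Suc d) = code_nth L d" for x L
    proof -
      have "rec_nat (prod_encode (x, L)) (\<lambda>_ l. snd (prod_decode l)) (Suc d) =
          rec_nat L (\<lambda>_ l. snd (prod_decode l)) d" by (induction d) simp_all
      then show ?thesis by (simp only: code_nth_def)
    qed
    then show ?thesis using Suc False d by (simp add: table_def)
  qed
qed simp

lemma set_decode_iff: "j \<in> set_decode m \<longleftrightarrow> m div 2 ^ j mod 2 = 1"
  by (simp add: set_decode_def odd_iff_mod_2_eq_one)

lemma set_encode_atMost: "set_encode {..n} = 2 ^ Suc n - 1"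
proof (induction n)
  case (Suc n)
  have "{..Suc n} = insert (Suc n) {..n}" by auto
  then show ?case using Suc by (simp add: set_encode_insert)
qed (simp add: set_encode_def)

text \<open>Correctness of the code function is kept apart from the particular machine. The
  condition on counters concerns every index, because the lemmas on substitution and reduction
  quantify over all of \<open>I\<close>.\<close>

locale presented_machine =
  fixes a :: nat and I :: "nat \<Rightarrow> instr"
  assumes fetch: "i \<le> last_index a \<Longrightarrow> fetch a i = instr_code (I i)"
    and wf: "i \<le> last_index a \<Longrightarrow> wf_instr (last_index a) (I i)"
    and counters: "counters (I i) \<subseteq> {0, 1}"
begin

lemma entry:
  "entry t (table a t) a = code_val (mrec_val I (t div Suc (last_index a)) (t mod Suc (last_index a)))"
proof (induction t rule: less_induct)
  case (less t)
  let ?K = "Suc (last_index a)"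
  define m where "m = t div ?K"
  define i where "i = t mod ?K"
  have t: "t = m * ?K + i" by (simp only: m_def i_def div_mult_mod_eq)
  have i: "i \<le> last_index a" using mod_less_divisor[of ?K t] by (simp add: i_def del: mod_less_divisor)
  have entry_eq: "entry t L a = (if i \<in> set_decode m
      then rec_code (fetch a i) i (target_code a t L (m - 2 ^ i) (label1 (fetch a i)))
        (target_code a t L (m - 2 ^ i) (label2 (fetch a i)))
      else code_val Unit)" for L
    by (simp only: entry_def Let_def m_def i_def set_decode_iff)
  have "entry t (table a t) a = code_val (mrec_val I m i)"
  proof (cases "i \<in> set_decode m")
    case False
    then show ?thesis by (simp only: entry_eq mrec_val.simps[of I m i] if_False)
  next
    case True
    let ?m = "m - 2 ^ i"
    let ?\<tau> = "\<lambda>j. if j \<in> set_decode ?m then mrec_val I ?m j else Var (fvar j)"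
    have "m \<noteq> 0" using True by (metis empty_iff set_decode_zero)
    then have m: "?m < m" by simp
    have target: "target_code a t (table a t) ?m j = code_val (?\<tau> j)" if j: "j \<le> last_index a" for j
    proof (cases "j \<in> set_decode ?m")
      case True
      let ?t = "?m * ?K + j"
      \<comment> \<open>A valid index \<open>j\<close> stays within the row of \<open>?m\<close>,
        and this row precedes that of \<open>m\<close>.\<close>
      have "?t < Suc ?m * ?K" using j by simp
      also have "\<dots> \<le> m * ?K" using m by (intro mult_le_mono1) simp
      also have "\<dots> \<le> t" by (simp add: t)
      finally have less_t: "?t < t" .
      have dm: "?t div ?K = ?m" "?t mod ?K = j" using j by (auto simp del: mult_Suc_right)
      have "target_code a t (table a t) ?m j = code_nth (table a t) (t - 1 - ?t)"
        using True by (simp only: target_code_def lookup_def set_decode_iff[symmetric] if_True)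
      also have "\<dots> = entry ?t (table a ?t) a" by (rule code_nth_table[OF less_t])
      also have "\<dots> = code_val (mrec_val I ?m j)"
        using less.IH[OF less_t] by (simp only: dm)
      finally show ?thesis using True by simp
    next
      case False
      then show ?thesis
        by (simp only: target_code_def fvar_def set_decode_iff[symmetric] if_False code_val.simps)
    qed
    have "entry t (table a t) a = rec_code (instr_code (I i)) i
        (target_code a t (table a t) ?m (label1 (instr_code (I i))))
        (target_code a t (table a t) ?m (label2 (instr_code (I i))))"
      using True by (simp only: entry_eq fetch[OF i] if_True)
    also have "\<dots> = code_val (Rec (fvar i) (fn_val (I i) ?\<tau>))"
      using label_le[OF wf[OF i]] by (simp only: target rec_code)
    also have "\<dots> = code_val (mrec_val I m i)"
      using True by (simp only: mrec_val.simps[of I m i] if_True)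
    finally show ?thesis .
  qed
  then show ?case by (simp only: m_def i_def)
qed

lemma prog_code: "prog_code a = code_comp (machine_prog (last_index a) I)"
proof -
  let ?n = "last_index a" and ?T = "table_length a"
  let ?u = "mrec_val I (set_encode {..?n})"
  let ?lets = "foldr (\<lambda>i. LetIn (fvar i) (Return (?u i)))"
  have look: "lookup a ?T (table a ?T) (2 ^ Suc ?n - 1) i = code_val (?u i)" if i: "i \<le> ?n" for i
  proof -
    \<comment> \<open>Position of index \<open>i\<close> in the last row, whose mask is the full
      set.\<close>
    let ?t = "(2 ^ Suc ?n - 1) * Suc ?n + i"
    have "x * Suc ?n + i < Suc x * Suc ?n" for x using i by simp
    then have "?t < Suc (2 ^ Suc ?n - 1) * Suc ?n" .
    also have "Suc (2 ^ Suc ?n - 1) = (2::nat) ^ Suc ?n" by (rule Suc_diff_1) simp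
    finally have "?t < ?T" by (simp only: table_length_def)
    from code_nth_table[OF this, of a] entry[of ?t]
    have "lookup a ?T (table a ?T) (2 ^ Suc ?n - 1) i =
        code_val (mrec_val I (?t div Suc ?n) (?t mod Suc ?n))"
      by (simp only: lookup_def)
    moreover have "?t div Suc ?n = 2 ^ Suc ?n - 1" "?t mod Suc ?n = i"
      using i by (auto simp del: mult_Suc_right power_Suc)
    ultimately show ?thesis by (simp only: set_encode_atMost)
  qed
  have "rec_nat (code_comp main_body) (\<lambda>s acc. let_code s acc a) s =
      code_comp (?lets [Suc ?n - s..<Suc ?n] main_body)" if "s \<le> Suc ?n" for s
    using that
  proof (induction s)
    case (Suc s)
    have "[Suc ?n - Suc s..<Suc ?n] = (?n - s) # [Suc ?n - s..<Suc ?n]"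
      using Suc.prems by (simp add: upt_conv_Cons Suc_diff_le del: upt_Suc)
    moreover have "rec_nat (code_comp main_body) (\<lambda>s acc. let_code s acc a) s =
      code_comp (?lets [Suc ?n - s..<Suc ?n] main_body)" using Suc by simp
    ultimately show ?case
      using look[of "?n - s"]
      by (simp add: let_code_def fvar_def del: upt_Suc power_Suc)
  qed simp
  from this[of "Suc ?n"] show ?thesis
    by (simp only: prog_code_def machine_prog_eq[OF counters] diff_self_eq_0 order_refl)
qed

end

section \<open>Recursiveness of the program code\<close>

lemma recursive_label:
  assumes "recursive k e"
  shows "recursive k (\<lambda>xs. label1 (e xs))" "recursive k (\<lambda>xs. label2 (e xs))"
  unfolding label1_def label2_def by (intro recursive_intros assms)+

lemma recursive_call_code: "recursive k u \<Longrightarrow> recursive k (\<lambda>xs. call_code (u xs))"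
  unfolding call_code_def by (intro recursive_intros)

lemma recursive_inst_comp_code:
  assumes "recursive k f" "recursive k i" "recursive k u" "recursive k w"
  shows "recursive k (\<lambda>xs. inst_comp_code (f xs) (i xs) (u xs) (w xs))"
  unfolding inst_comp_code_def by (intro recursive_intros recursive_call_code assms)

lemma recursive_rec_code:
  assumes "recursive k e" "recursive k i" "recursive k u" "recursive k w"
  shows "recursive k (\<lambda>xs. rec_code (e xs) (i xs) (u xs) (w xs))"
  unfolding rec_code_def by (intro recursive_intros recursive_inst_comp_code assms)

lemma recursive_last_index: "recursive k a \<Longrightarrow> recursive k (\<lambda>xs. last_index (a xs))"
  unfolding last_index_def by (intro recursive_intros)

lemma recursive_fetch:
  assumes "recursive k a" "recursive k i"
  shows "recursive k (\<lambda>xs. fetch (a xs) (i xs))"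
  unfolding fetch_def by (intro recursive_intros recursive_last_index assms)

lemma recursive_lookup:
  assumes "recursive k a" "recursive k t" "recursive k L" "recursive k m" "recursive k j"
  shows "recursive k (\<lambda>xs. lookup (a xs) (t xs) (L xs) (m xs) (j xs))"
  unfolding lookup_def by (intro recursive_intros recursive_last_index assms)

lemma recursive_target_code:
  assumes "recursive k a" "recursive k t" "recursive k L" "recursive k m" "recursive k j"
  shows "recursive k (\<lambda>xs. target_code (a xs) (t xs) (L xs) (m xs) (j xs))"
  unfolding target_code_def by (intro recursive_intros recursive_lookup assms)

lemma recursive_entry:
  assumes "recursive k t" "recursive k L" "recursive k a"
  shows "recursive k (\<lambda>xs. entry (t xs) (L xs) (a xs))"
  unfolding entry_def Let_def
  by (intro recursive_intros recursive_rec_code recursive_target_code recursive_label recursive_fetch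
      recursive_last_index assms)

lemma recursive_table:
  assumes "recursive k a" "recursive k t"
  shows "recursive k (\<lambda>xs. table (a xs) (t xs))"
  unfolding table_def
  by (rule recursive_rec_nat[where b = "\<lambda>_. 0" and g = "\<lambda>t L a. prod_encode (entry t L a, L)"])
    (intro recursive_intros recursive_entry assms; simp)+

lemma recursive_let_code:
  assumes "recursive k s" "recursive k acc" "recursive k a"
  shows "recursive k (\<lambda>xs. let_code (s xs) (acc xs) (a xs))"
  unfolding let_code_def table_length_def
  by (intro recursive_intros recursive_lookup recursive_table recursive_last_index assms)

lemma recursive_prog_code: "recursive k a \<Longrightarrow> recursive k (\<lambda>xs. prog_code (a xs))"
  unfolding prog_code_def
  by (rule recursive_rec_nat[where b = "\<lambda>_. code_comp main_body" and g = let_code])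
    (intro recursive_intros recursive_let_code recursive_last_index; simp)+

section \<open>Diagonalization\<close>

theorem theorem7:
  shows "\<not> decidable_problem
           (\<lambda>(n, P). prod_encode (n, code_comp P))
           {(n, P). P \<in> MM n}
           (\<lambda>(n, P). P \<rightarrow>c* Return TT)"
proof
  assume "decidable_problem (\<lambda>(n, P). prod_encode (n, code_comp P)) {(n, P). P \<in> MM n}
           (\<lambda>(n, P). P \<rightarrow>c* Return TT)"
  then obtain r where r: "\<And>n P. P \<in> MM n \<Longrightarrow>
      reval r [prod_encode (n, code_comp P)] (if P \<rightarrow>c* Return TT then 1 else 0)"
    unfolding decidable_problem_def by fastforce
  \<comment> \<open>The number of the instance on which \<open>r\<close> is to be consulted, as a
    function of the presentation.\<close>
  have "recursive 1 (\<lambda>xs. prod_encode (last_index (xs ! 0), prog_code (xs ! 0)))"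
    by (intro recursive_prod_encode recursive_last_index recursive_prog_code recursive_proj) simp_all
  then obtain rq where rq: "\<And>a. reval rq [a] (prod_encode (last_index a, prog_code a))"
    unfolding recursive_def by (metis One_nat_def length_Cons list.size(3) nth_Cons_0)
  \<comment> \<open>Argument in register 0, answer in register 1, work space from register 2
    on.\<close>
  define p where "p = compile (RComp r [rq]) [0] 1 2"
  obtain K where K: "regs p \<union> {0, 1} \<subseteq> {..<K}"
    using finite_nat_bounded[of "regs p \<union> {0, 1}"] finite_regs by auto
  \<comment> \<open>Layout: a jump at 0, \<open>p\<close> from 1, the test of register 1 from
    \<open>e\<close>, then \<open>halt\<close> and the idle loop at \<open>n0\<close>; the offsets
    are the code lengths.\<close>
  define e where "e = 1 + plen p"
  define halt where "halt = e + 2 * prm 1 + 4"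
  define n0 where "n0 = Suc halt"
  \<comment> \<open>Both labels of the first instruction agree, so it is a jump; counter 0 is still
    zero and stays so. The target, the first increment, depends on \<open>n0\<close> only, so
    \<open>B\<close> is fixed before \<open>a\<close>.\<close>
  define B where "B = CDec 0 (Suc n0) (Suc n0) # pcode p 1 e @ divcode (prm 1) e n0 halt @
    [CHalt, CInc 0 n0]"
  define a where "a = prod_encode (n0, list_code (map instr_code B))"
  define I where
    "I = (\<lambda>i. if i \<le> n0 then B ! i else CInc 0 (if i = last_index a then 1 else Suc i))"
  have lenB: "length B = Suc n0"
    by (simp add: B_def length_pcode length_divcode n0_def halt_def e_def)
  have last: "last_index a = n0 + prm 0 ^ a" by (simp add: last_index_def a_def)
  have pos: "prm 0 ^ a > 0" by (simp add: prm_pos)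
  have wfB: "wf_instr (last_index a) c" if "c \<in> set B" for c
  proof -
    \<comment> \<open>The block of increments is not empty, so its first index is a legal
      label.\<close>
    have *: "Suc n0 \<le> last_index a" using pos last by linarith
    from that consider "c = CDec 0 (Suc n0) (Suc n0)" | "c \<in> set (pcode p 1 e)"
      | "c \<in> set (divcode (prm 1) e n0 halt)" | "c = CHalt" | "c = CInc 0 n0"
      by (auto simp: B_def)
    then show ?thesis
    proof cases
      case 2
      then show ?thesis by (rule wf_pcode) (use * in \<open>auto simp: n0_def halt_def e_def\<close>)
    next
      case 3
      then show ?thesis by (rule wf_divcode) (use * in \<open>auto simp: n0_def halt_def e_def\<close>)
    qed (use * in \<open>auto simp: wf_instr_def\<close>)
  qed
  interpret presented_machine a I
  proof
    fix i
    show "fetch a i = instr_code (I i)"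
    proof (cases "i \<le> n0")
      case True
      then show ?thesis using lenB
        by (simp add: fetch_def I_def a_def code_nth_list_code)
    next
      case False
      have "fst (prod_decode a) = n0" by (simp add: a_def)
      with False show ?thesis by (simp add: fetch_def I_def instr_code_def)
    qed
    show "wf_instr (last_index a) (I i)" if "i \<le> last_index a"
    proof (cases "i \<le> n0")
      case True
      then show ?thesis using wfB lenB by (simp add: I_def)
    next
      case False
      then show ?thesis using that by (auto simp: I_def wf_instr_def)
    qed
    show "counters (I i) \<subseteq> {0, 1}"
      using wfB[of "B ! i"] lenB by (auto simp: I_def wf_instr_def)
  qed
  let ?P = "machine_prog (last_index a) I"
  define z :: nat where "z = (if ?P \<rightarrow>c* Return TT then 1 else 0)"
  \<comment> \<open>The presented program is itself an instance, so \<open>r\<close> is bound to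
    answer on it; \<open>z\<close> is that answer.\<close>
  have "reval r [prod_encode (last_index a, prog_code a)] z"
    unfolding z_def prog_code by (rule r[OF machine_prog_MM[OF wf]])
  then have rev: "reval (RComp r [rq]) [a] z" using rq by (auto intro!: reval_Comp)
  define s :: "nat \<Rightarrow> nat" where "s = (\<lambda>_. 0)(0 := a)"
  have ex: "exec p s (s(1 := z))"
    unfolding p_def by (rule exec_compile) (use rev in \<open>auto simp: s_def\<close>)
  have code: "code_at I 0 B" unfolding code_at_def I_def by (simp add: lenB)
  have I0: "I 0 = CDec 0 (Suc n0) (Suc n0)" and
    code_p: "code_at I 1 (pcode p 1 e)" and
    code_div: "code_at I e (divcode (prm 1) e n0 halt)" and
    I_halt: "I halt = CHalt" and I_n0: "I n0 = CInc 0 n0"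
    using code unfolding B_def code_at_Cons code_at_append
    by (simp_all add: length_pcode length_divcode e_def halt_def n0_def add.assoc)
  have prelude: "reach I (Suc n0 + k, k, 0) (1, prm 0 ^ a, 0)" if "k < prm 0 ^ a" for k
  proof -
    \<comment> \<open>Induction on the number \<open>d\<close> of increments left after the current
      one, as the end of the block is the base case.\<close>
    have "d < prm 0 ^ a \<Longrightarrow> reach I (Suc n0 + (prm 0 ^ a - Suc d), prm 0 ^ a - Suc d, 0)
        (1, prm 0 ^ a, 0)" for d
    proof (induction d)
      case 0
      have "mnext I (Suc n0 + (prm 0 ^ a - 1), prm 0 ^ a - 1, 0) = (1, prm 0 ^ a, 0)"
        using pos by (simp add: I_def last)
      then show ?case by (auto intro: reach_step reach_refl)
    next
      case (Suc d)
      have "mnext I (Suc n0 + (prm 0 ^ a - Suc (Suc d)), prm 0 ^ a - Suc (Suc d), 0) =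
          (Suc n0 + (prm 0 ^ a - Suc d), prm 0 ^ a - Suc d, 0)"
        using Suc.prems by (auto simp: I_def last)
      then show ?case using Suc by (auto intro: reach_step)
    qed
    from this[of "prm 0 ^ a - Suc k"] that show ?thesis by (simp add: Suc_diff_Suc)
  qed
  \<comment> \<open>Only register 0 of the initial store is filled, with \<open>a\<close>; this
    dictates the number of increments.\<close>
  have "goedel K s = prm 0 ^ a"
  proof -
    have "goedel K s = (\<Prod>r\<in>{0}. prm r ^ s r)"
      unfolding goedel_def by (rule prod.mono_neutral_right) (use K in \<open>auto simp: s_def\<close>)
    then show ?thesis by (simp add: s_def)
  qed
  moreover have "mnext I (0, 0, 0) = (Suc n0 + 0, 0, 0)" using I0 by simp
  ultimately have "reach I (0, 0, 0) (1, goedel K s, 0)"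
    using prelude[of 0] pos reach_step by metis
  moreover have "reach I (1, goedel K s, 0) (e, goedel K (s(1 := z)), 0)"
    by (rule reach_pcode[OF ex _ code_p]) (use K in simp)
  ultimately have run: "reach I (0, 0, 0) (e, goedel K (s(1 := z)), 0)" by (rule reach_trans)
  have dvd: "prm 1 dvd goedel K (s(1 := z)) \<longleftrightarrow> z > 0"
    using prm_dvd_goedel[of 1 K "s(1 := z)"] K by simp
  \<comment> \<open>A positive \<open>z\<close> makes the Goedel number divisible by
    \<open>prm 1\<close> and leads to the idle loop at \<open>n0\<close>; otherwise the test exits
    to \<open>halt\<close>.\<close>
  have "halts I (0, 0, 0) \<longleftrightarrow> z = 0"
  proof (cases "z = 0")
    case True
    then have "reach I (e, goedel K (s(1 := z)), 0) (halt, goedel K (s(1 := z)), 0)"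
      using reach_divcode(2)[OF code_div prm_pos] dvd by simp
    from reach_halts[OF reach_trans[OF run this]] show ?thesis
      using True halts_CHalt[of I halt] I_halt by simp
  next
    case False
    then have "reach I (e, goedel K (s(1 := z)), 0) (n0, goedel K (s(1 := z)) div prm 1, 0)"
      using reach_divcode(1)[OF code_div prm_pos] dvd by simp
    from reach_halts[OF reach_trans[OF run this]] show ?thesis
      using False not_halts_self_loop[of I n0 0] I_n0 by simp
  qed
  moreover have "?P \<rightarrow>c* Return TT \<longleftrightarrow> halts I (0, 0, 0)"
    by (rule machine_prog_halts[OF wf counters])
  ultimately show False by (auto simp: z_def split: if_splits)
qed

end
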